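(* Let the target process be $\xi_t=\xi_0+M_t$, $0\le t\le T$, where $\xi_0\in\mathbb R$ is deterministic and $M$ is a continuous square-integrable martingale with $M_0=0$. Then, for $\kappa>0$, $$v(\kappa)=\frac{\sqrt\kappa}{2}\tanh\!\Big(\frac{T}{\sqrt\kappa}\Big)(x-\xi_0)^2+\frac12\,\mathbb E\int_0^T\sqrt\kappa\,\tanh\!\Big(\frac{T-t}{\sqrt\kappa}\Big)\,d\langle M\rangle_t .$$ In particular, $$v(\kappa)=\frac{\sqrt\kappa}{2}\Bigl((x-\xi_0)^2+\mathbb E[\langle M\rangle_T]\Bigr)+o(\sqrt\kappa),\qquad\kappa\downarrow0,$$ so that the $\sqrt\kappa$ rate is sharp whenever $\xi$ is not identically equal to $x$.
   Context: Fix $T>0$, a filtered probability space $(\Omega,\mathcal F,(\mathcal F_t)_{0\le t\le T},\mathbb P)$ satisfying the usual conditions, and $x\in\mathbb R$. Let $\mathcal U$ be the set of progressively measurable processes $u=(u_t)_{0\le t\le T}$ with $\mathbb E\int_0^T u_t^2\,dt<\infty$, and for $u\in\mathcal U$ let $X^u_t=x+\int_0^t u_s\,ds$. For $\kappa\ge0$, $$J_\kappa(u)=\mathbb E\Big[\tfrac12\int_0^T(X^u_t-\xi_t)^2\,dt+\tfrac{\kappa}{2}\int_0^Tu_t^2\,dt\Big],\qquad v(\kappa)=\inf_{u\in\mathcal U}J_\kappa(u).$$ $\langle M\rangle$ denotes the quadratic variation of $M$. *)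

theory Defs
  imports "HOL-Probability.Probability" "HOL-Library.Landau_Symbols"
begin

text \<open>
  Processes on the time interval \<open>[0,T]\<close> are functions \<open>real \<Rightarrow> 'a \<Rightarrow> real\<close> (time first), and the
  filtration is a family \<open>F :: real \<Rightarrow> 'a measure\<close> of which only the sigma-algebras \<open>F t\<close> matter.
  Everything is constrained on \<open>{0..T}\<close> only; values at other times are irrelevant.
\<close>

text \<open>
  The usual conditions: \<open>P\<close> is complete, \<open>F 0\<close> contains all \<open>P\<close>-null sets, and the filtration is
  right-continuous on \<open>[0,T)\<close>.
\<close>

definition usual_filtered_prob_space ::
  "real \<Rightarrow> 'a measure \<Rightarrow> (real \<Rightarrow> 'a measure) \<Rightarrow> bool" where
  "usual_filtered_prob_space T P F \<longleftrightarrow>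
     prob_space P \<and> complete_measure P \<and>
     (\<forall>t\<in>{0..T}. subalgebra P (F t)) \<and>
     (\<forall>s\<in>{0..T}. \<forall>t\<in>{0..T}. s \<le> t \<longrightarrow> sets (F s) \<subseteq> sets (F t)) \<and>
     null_sets P \<subseteq> sets (F 0) \<and>
     (\<forall>t\<in>{0..<T}. sets (F t) = (\<Inter>s\<in>{t<..T}. sets (F s)))"

definition progressively_measurable ::
  "real \<Rightarrow> (real \<Rightarrow> 'a measure) \<Rightarrow> (real \<Rightarrow> 'a \<Rightarrow> real) \<Rightarrow> bool" where
  "progressively_measurable T F u \<longleftrightarrow>
     (\<forall>t\<in>{0..T}. (\<lambda>(s, \<omega>). u s \<omega>) \<in> borel_measurable (restrict_space borel {0..t} \<Otimes>\<^sub>M F t))"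

definition martingale_on ::
  "real \<Rightarrow> 'a measure \<Rightarrow> (real \<Rightarrow> 'a measure) \<Rightarrow> (real \<Rightarrow> 'a \<Rightarrow> real) \<Rightarrow> bool" where
  "martingale_on T P F M \<longleftrightarrow>
     (\<forall>t\<in>{0..T}. M t \<in> borel_measurable (F t) \<and> integrable P (M t)) \<and>
     (\<forall>s\<in>{0..T}. \<forall>t\<in>{0..T}. s \<le> t \<longrightarrow> (AE \<omega> in P. real_cond_exp P (F s) (M t) \<omega> = M s \<omega>))"

text \<open>Continuity of paths is required almost surely.\<close>

definition continuous_square_integrable_martingale ::
  "real \<Rightarrow> 'a measure \<Rightarrow> (real \<Rightarrow> 'a measure) \<Rightarrow> (real \<Rightarrow> 'a \<Rightarrow> real) \<Rightarrow> bool" where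
  "continuous_square_integrable_martingale T P F M \<longleftrightarrow>
     martingale_on T P F M \<and>
     (\<forall>t\<in>{0..T}. integrable P (\<lambda>\<omega>. (M t \<omega>)\<^sup>2)) \<and>
     (AE \<omega> in P. continuous_on {0..T} (\<lambda>t. M t \<omega>))"

text \<open>
  \<open>A\<close> is a version of the quadratic variation of the continuous square-integrable martingale \<open>M\<close>:
  the continuous increasing adapted process started at \<open>0\<close> in the Doob--Meyer decomposition of
  \<open>M\<^sup>2\<close>.  Such a process exists under the usual conditions and is unique up to
  indistinguishability.
\<close>

definition quadratic_variation_of ::
  "real \<Rightarrow> 'a measure \<Rightarrow> (real \<Rightarrow> 'a measure) \<Rightarrow> (real \<Rightarrow> 'a \<Rightarrow> real) \<Rightarrow> (real \<Rightarrow> 'a \<Rightarrow> real) \<Rightarrow> bool"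
where
  "quadratic_variation_of T P F M A \<longleftrightarrow>
     (\<forall>t\<in>{0..T}. A t \<in> borel_measurable (F t)) \<and>
     (AE \<omega> in P. A 0 \<omega> = 0 \<and> continuous_on {0..T} (\<lambda>t. A t \<omega>) \<and> mono_on {0..T} (\<lambda>t. A t \<omega>)) \<and>
     martingale_on T P F (\<lambda>t \<omega>. (M t \<omega>)\<^sup>2 - A t \<omega>)"

text \<open>
  The Lebesgue--Stieltjes measure of a continuous increasing function on \<open>[0,T]\<close>.  As
  \<open>interval_measure\<close> takes a function on the whole line, \<open>g\<close> is frozen outside \<open>[0,T]\<close>, so the
  measure has no mass there and no atom at \<open>0\<close>.
\<close>

definition stieltjes_measure :: "real \<Rightarrow> (real \<Rightarrow> real) \<Rightarrow> real measure" where
  "stieltjes_measure T g = interval_measure (\<lambda>t. g (max 0 (min T t)))"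

definition controls ::
  "real \<Rightarrow> 'a measure \<Rightarrow> (real \<Rightarrow> 'a measure) \<Rightarrow> (real \<Rightarrow> 'a \<Rightarrow> real) set" where
  "controls T P F =
     {u. progressively_measurable T F u \<and>
         (\<integral>\<^sup>+\<omega>. (\<integral>\<^sup>+t\<in>{0..T}. ennreal ((u t \<omega>)\<^sup>2) \<partial>lborel) \<partial>P) < \<infinity>}"

text \<open>
  For a control, almost every path is square integrable on \<open>[0,T]\<close>, so the Lebesgue integral
  below is proper outside a null set of \<open>\<omega>\<close>.
\<close>

definition controlled_state :: "real \<Rightarrow> (real \<Rightarrow> 'a \<Rightarrow> real) \<Rightarrow> real \<Rightarrow> 'a \<Rightarrow> real" where
  "controlled_state x u t \<omega> = x + (LBINT s:{0..t}. u s \<omega>)"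

text \<open>
  The integrands of the cost are nonnegative (for \<open>\<kappa> \<ge> 0\<close>), so the cost is taken in \<open>[0,\<infinity>]\<close>;
  this makes it, and its infimum, meaningful without integrability assumptions.
\<close>

definition tracking_cost ::
  "real \<Rightarrow> 'a measure \<Rightarrow> (real \<Rightarrow> 'a \<Rightarrow> real) \<Rightarrow> real \<Rightarrow> real \<Rightarrow> (real \<Rightarrow> 'a \<Rightarrow> real) \<Rightarrow> ennreal" where
  "tracking_cost T P \<xi> x \<kappa> u =
     (\<integral>\<^sup>+\<omega>. (ennreal (1/2) * (\<integral>\<^sup>+t\<in>{0..T}. ennreal ((controlled_state x u t \<omega> - \<xi> t \<omega>)\<^sup>2) \<partial>lborel)
            + ennreal (\<kappa>/2) * (\<integral>\<^sup>+t\<in>{0..T}. ennreal ((u t \<omega>)\<^sup>2) \<partial>lborel)) \<partial>P)"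

definition tracking_value ::
  "real \<Rightarrow> 'a measure \<Rightarrow> (real \<Rightarrow> 'a measure) \<Rightarrow> (real \<Rightarrow> 'a \<Rightarrow> real) \<Rightarrow> real \<Rightarrow> real \<Rightarrow> ennreal" where
  "tracking_value T P F \<xi> x \<kappa> = (INF u\<in>controls T P F. tracking_cost T P \<xi> x \<kappa> u)"

end

theory Submission
  imports Defs
begin

text \<open>
  Write \<open>k = sqrt \<kappa>\<close>, \<open>p t = k tanh ((T - t) / k)\<close>, \<open>q = - p' = 1 - p\<^sup>2 / k\<^sup>2\<close> and \<open>Z = X - \<xi>0\<close>.
  Completing the square in the running cost leaves \<open>k\<^sup>2/2 (u + p (Z - M) / k\<^sup>2)\<^sup>2 + q M\<^sup>2 / 2\<close>,
  minus half the derivative of \<open>p Z\<^sup>2\<close>, plus \<open>(p Z)' M\<close>.  Since \<open>p T = 0\<close>, the derivative of \<open>p Z\<^sup>2\<close>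
  integrates to a constant.  No stochastic calculus is needed for the last term: \<open>(p Z)'\<close> at time
  \<open>t\<close> is known at time \<open>t\<close>, so in the expectation \<open>M t\<close> may be replaced by \<open>M T\<close>, and what remains
  is \<open>- p 0 Z 0\<close> times the mean of \<open>M T\<close>, which is \<open>0\<close>.  As \<open>M\<^sup>2\<close> and
  \<open>A\<close> have the same mean, integration by parts turns the \<open>q M\<^sup>2\<close> term into the Stieltjes integral of \<open>p\<close> against \<open>A\<close>.  The square vanishes for
  the feedback control, whose linear state equation is solved explicitly path by path.
  For the asymptotics, the mean of \<open>A\<close> is nondecreasing and left-continuous at \<open>T\<close>, and the mass
  of \<open>q\<close> concentrates there.
\<close>

subsection \<open>Paths\<close>

text \<open>Absolute continuity with density \<open>f\<close>, phrased as an integral identity: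
  \<open>f\<close> matters only almost everywhere, and the product rule becomes an instance of
  Fubini rather than a statement about derivatives.\<close>

definition primitive_on :: "real \<Rightarrow> (real \<Rightarrow> real) \<Rightarrow> (real \<Rightarrow> real) \<Rightarrow> bool" where
  "primitive_on T F f \<longleftrightarrow> set_integrable lborel {0..T} f \<and>
     (\<forall>t\<in>{0..T}. F t = F 0 + (LBINT s:{0..t}. f s))"

lemma primitive_onD:
  assumes "primitive_on T F f" "t \<in> {0..T}"
  shows "set_integrable lborel {0..t} f" "F t = F 0 + (LBINT s:{0..t}. f s)"
proof -
  have "set_integrable lborel {0..T} f"
    using assms(1) unfolding primitive_on_def by (rule conjunct1)
  then show "set_integrable lborel {0..t} f"
    by (rule set_integrable_subset) (use assms(2) in auto)
  show "F t = F 0 + (LBINT s:{0..t}. f s)"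
    using assms unfolding primitive_on_def by blast
qed

lemma set_integral_singleton_lborel [simp]: "(LBINT s:{a}. f s) = 0" for f :: "real \<Rightarrow> real"
  unfolding set_lebesgue_integral_def
  by (rule integral_eq_zero_AE, rule eventually_mono[OF AE_lborel_singleton[of a]]) simp

lemma primitive_on_integral:
  assumes "set_integrable lborel {0..T} f"
  shows "primitive_on T (\<lambda>t. a + (LBINT s:{0..t}. f s)) f"
  using assms by (simp add: primitive_on_def)

lemma primitive_on_FTC:
  assumes "\<And>t. (F has_real_derivative f t) (at t)" "\<And>t. isCont f t"
  shows "primitive_on T F f"
proof -
  have *: "has_bochner_integral lborel (\<lambda>x. f x * indicator {0..t} x) (F t - F 0)" if "0 \<le> t" for t
    by (rule has_bochner_integral_FTC_Icc_real) (use that assms in auto)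
  show ?thesis
    unfolding primitive_on_def set_integrable_def set_lebesgue_integral_def
    using *[THEN has_bochner_integral_integral_eq]
      *[THEN integrable.intros]
    by (cases "0 \<le> T") (auto simp: mult.commute)
qed

section \<open>Product rule for absolutely continuous functions\<close>

lemma integrable_pair_times:
  fixes f g :: "real \<Rightarrow> real"
  assumes "integrable lborel f" "integrable lborel g"
  shows "integrable (lborel \<Otimes>\<^sub>M lborel) (\<lambda>(s, r). f s * g r)"
proof -
  have [measurable]: "f \<in> borel_measurable borel" "g \<in> borel_measurable borel"
    using assms by auto
  show ?thesis
    by (rule lborel_pair.Fubini_integrable) (use assms in \<open>auto simp: abs_mult\<close>)
qed

text \<open>The product of the two integrals is an integral over the square
  \<open>[0,t] x [0,t]\<close>. Cutting the square along its diagonal and integrating each triangle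
  in the convenient order (Fubini) gives the two summands.\<close>

lemma set_integral_mult_primitive:
  fixes f g :: "real \<Rightarrow> real"
  assumes f: "set_integrable lborel {0..t} f" and g: "set_integrable lborel {0..t} g"
  shows "set_integrable lborel {0..t} (\<lambda>s. f s * (LBINT r:{0..s}. g r))"
    and "(LBINT s:{0..t}. f s) * (LBINT s:{0..t}. g s) =
      (LBINT s:{0..t}. f s * (LBINT r:{0..s}. g r)) + (LBINT s:{0..t}. g s * (LBINT r:{0..s}. f r))"
proof -
  define f' g' where "f' = (\<lambda>s. indicator {0..t} s * f s)" and "g' = (\<lambda>s. indicator {0..t} s * g s)"
  have i: "integrable lborel f'" "integrable lborel g'"
    using f g by (auto simp: f'_def g'_def set_integrable_def)
  have [measurable]: "f' \<in> borel_measurable borel" "g' \<in> borel_measurable borel" using i by auto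
  note ip = integrable_pair_times[OF i]
  have mI: "(\<lambda>(s, r). f' s * g' r * indicator {..s} r) \<in> borel_measurable (lborel \<Otimes>\<^sub>M lborel)"
    by (auto simp: indicator_def)
  have mJ: "(\<lambda>(s, r). f' s * g' r * indicator {..<r} s) \<in> borel_measurable (lborel \<Otimes>\<^sub>M lborel)"
    by (auto simp: indicator_def)
  have I1: "integrable (lborel \<Otimes>\<^sub>M lborel) (\<lambda>(s, r). f' s * g' r * indicator {..s} r)"
    by (rule Bochner_Integration.integrable_bound[OF ip mI]) (auto split: split_indicator)
  have I2: "integrable (lborel \<Otimes>\<^sub>M lborel) (\<lambda>(s, r). f' s * g' r * indicator {..<r} s)"
    by (rule Bochner_Integration.integrable_bound[OF ip mJ]) (auto split: split_indicator)
  have e1: "(\<integral>r. f' s * g' r * indicator {..s} r \<partial>lborel) =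
      indicator {0..t} s * (f s * (LBINT r:{0..s}. g r))" for s
  proof -
    have "(\<integral>r. f' s * g' r * indicator {..s} r \<partial>lborel)
        = (\<integral>r. f' s * (indicator {0..s} r * g r) \<partial>lborel)"
      by (rule Bochner_Integration.integral_cong) (auto simp: f'_def g'_def split: split_indicator)
    also have "\<dots> = f' s * (\<integral>r. indicator {0..s} r * g r \<partial>lborel)" by simp
    finally show ?thesis by (simp add: f'_def set_lebesgue_integral_def)
  qed
  \<comment> \<open>The cut is strict on this side so that the triangles are disjoint. The inner
    integral over \<open>s < r\<close> then differs from the one over \<open>{0..r}\<close> only at
    the null point \<open>s = r\<close>.\<close>
  have e2: "(\<integral>s. f' s * g' r * indicator {..<r} s \<partial>lborel) =
      indicator {0..t} r * (g r * (LBINT s:{0..r}. f s))" for r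
  proof -
    have "(\<integral>s. f' s * g' r * indicator {..<r} s \<partial>lborel)
        = (\<integral>s. g' r * (indicator {0..r} s * f' s) \<partial>lborel)"
      by (intro integral_cong_AE; measurable?)
        (use AE_lborel_singleton[of r] in \<open>auto simp: f'_def split: split_indicator\<close>)
    also have "\<dots> = g' r * (\<integral>s. indicator {0..r} s * f' s \<partial>lborel)" by simp
    also have "\<dots> = g' r * (\<integral>s. indicator {0..r} s * f s \<partial>lborel)"
      by (cases "r \<le> t")
        (auto simp: g'_def f'_def split: split_indicator intro!: Bochner_Integration.integral_cong)
    finally show ?thesis by (simp add: g'_def set_lebesgue_integral_def)
  qed
  show "set_integrable lborel {0..t} (\<lambda>s. f s * (LBINT r:{0..s}. g r))"
    using lborel_pair.integrable_fst[OF I1] by (simp add: e1 set_integrable_def)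
  have "(LBINT s:{0..t}. f s) * (LBINT s:{0..t}. g s) = (\<integral>s. (\<integral>r. f' s * g' r \<partial>lborel) \<partial>lborel)"
    by (simp add: set_lebesgue_integral_def f'_def g'_def)
  also have "\<dots> = (\<integral>(s, r). f' s * g' r \<partial>(lborel \<Otimes>\<^sub>M lborel))"
    by (rule lborel_pair.integral_fst[OF ip])
  also have "\<dots> = (\<integral>x. (case x of (s, r) \<Rightarrow> f' s * g' r * indicator {..s} r) +
       (case x of (s, r) \<Rightarrow> f' s * g' r * indicator {..<r} s) \<partial>(lborel \<Otimes>\<^sub>M lborel))"
    by (rule Bochner_Integration.integral_cong) (auto split: split_indicator)
  also have "\<dots> = (\<integral>s. (\<integral>r. f' s * g' r * indicator {..s} r \<partial>lborel) \<partial>lborel)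
      + (\<integral>r. (\<integral>s. f' s * g' r * indicator {..<r} s \<partial>lborel) \<partial>lborel)"
    using I1 I2 by (simp add: lborel_pair.integral_fst[OF I1] lborel_pair.integral_snd[OF I2])
  finally show "(LBINT s:{0..t}. f s) * (LBINT s:{0..t}. g s) =
      (LBINT s:{0..t}. f s * (LBINT r:{0..s}. g r)) + (LBINT s:{0..t}. g s * (LBINT r:{0..s}. f r))"
    by (simp add: e1 e2 set_lebesgue_integral_def)
qed

text \<open>Writing each factor as its initial value plus an integral, the mixed terms are linear
  and the product of the two integrals is the preceding lemma.\<close>

lemma primitive_on_mult:
  assumes F: "primitive_on T F f" and G: "primitive_on T G g"
  shows "primitive_on T (\<lambda>t. F t * G t) (\<lambda>t. f t * G t + F t * g t)"
proof -
  let ?F = "\<lambda>t. LBINT s:{0..t}. f s" and ?G = "\<lambda>t. LBINT s:{0..t}. g s"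
  have key: "set_integrable lborel {0..t} (\<lambda>s. f s * G s + F s * g s)
      \<and> (LBINT s:{0..t}. f s * G s + F s * g s) = F t * G t - F 0 * G 0" if t: "t \<in> {0..T}" for t
  proof -
    note f = primitive_onD[OF F t] and g = primitive_onD[OF G t]
    have s: "s \<in> {0..T}" if "s \<in> {0..t}" for s using that t by auto
    have eq: "f s * G s + F s * g s = G 0 * f s + F 0 * g s + (f s * ?G s + g s * ?F s)" if "s \<in> {0..t}" for s
      using primitive_onD(2)[OF F s[OF that]] primitive_onD(2)[OF G s[OF that]] by (simp add: algebra_simps)
    note i = set_integral_mult_primitive(1)[OF f(1) g(1)] set_integral_mult_primitive(1)[OF g(1) f(1)]
    have i1: "set_integrable lborel {0..t} (\<lambda>s. G 0 * f s + F 0 * g s)"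
      using f(1) g(1) by (intro set_integral_add) auto
    have "set_integrable lborel {0..t} (\<lambda>s. G 0 * f s + F 0 * g s + (f s * ?G s + g s * ?F s))"
      by (intro set_integral_add i i1)
    moreover have "(LBINT s:{0..t}. G 0 * f s + F 0 * g s + (f s * ?G s + g s * ?F s))
        = G 0 * ?F t + F 0 * ?G t + ?F t * ?G t"
      using f(1) g(1) i i1 by (simp add: set_integral_mult_primitive(2))
    moreover have "set_integrable lborel {0..t} (\<lambda>s. f s * G s + F s * g s) \<longleftrightarrow>
        set_integrable lborel {0..t} (\<lambda>s. G 0 * f s + F 0 * g s + (f s * ?G s + g s * ?F s))"
      by (rule set_integrable_cong) (use eq in auto)
    moreover have "(LBINT s:{0..t}. f s * G s + F s * g s) =
        (LBINT s:{0..t}. G 0 * f s + F 0 * g s + (f s * ?G s + g s * ?F s))"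
      by (rule set_lebesgue_integral_cong) (use eq in auto)
    ultimately show ?thesis
      unfolding f(2) g(2) by (simp add: algebra_simps)
  qed
  show ?thesis
  proof (cases "0 \<le> T")
    case True
    then show ?thesis using key[of T] key by (auto simp: primitive_on_def)
  next
    case False
    then have "{0..T} = {}" by simp
    then show ?thesis unfolding primitive_on_def set_integrable_def by simp
  qed
qed

section \<open>Path estimates and Stieltjes integration by parts\<close>

lemma set_integrable_const_Icc: "set_integrable lborel {a..b} (\<lambda>s. c :: real)" for a b :: real
  unfolding set_integrable_def
  by (intro integrable_scaleR_left integrable_real_indicator) (simp_all add: emeasure_lborel_Icc_eq)

lemma set_integrable_of_power2:
  fixes u :: "real \<Rightarrow> real"
  assumes u: "set_borel_measurable lborel {0..t} u" and u2: "set_integrable lborel {0..t} (\<lambda>s. (u s)\<^sup>2)"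
  shows "set_integrable lborel {0..t} u"
proof (rule set_integrable_bound[OF set_integral_add(1)[OF set_integrable_const_Icc[of 0 t 1] u2] u])
  have "\<bar>y\<bar> \<le> \<bar>1 + y\<^sup>2\<bar>" for y :: real
  proof (cases "\<bar>y\<bar> \<le> 1")
    case True
    then show ?thesis using zero_le_power2[of y] by linarith
  next
    case False
    then have "\<bar>y\<bar> * 1 \<le> \<bar>y\<bar> * \<bar>y\<bar>" by (intro mult_left_mono) linarith+
    then have "\<bar>y\<bar> \<le> y\<^sup>2" by (simp add: power2_eq_square)
    then show ?thesis by linarith
  qed
  then show "AE s in lborel. s \<in> {0..t} \<longrightarrow> norm (u s) \<le> norm (1 + (u s)\<^sup>2)"
    unfolding real_norm_def by (intro AE_I2 impI)
qed

text \<open>Cauchy-Schwarz against the constant 1, obtained by expanding the nonnegative integral of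
  \<open>(u - c)\<close> squared, where \<open>c\<close> is the mean of \<open>u\<close> over
  \<open>[0,t]\<close>.\<close>

lemma set_integral_power2_le:
  fixes u :: "real \<Rightarrow> real"
  assumes t: "0 \<le> t" and u: "set_integrable lborel {0..t} u" and u2: "set_integrable lborel {0..t} (\<lambda>s. (u s)\<^sup>2)"
  shows "(LBINT s:{0..t}. u s)\<^sup>2 \<le> t * (LBINT s:{0..t}. (u s)\<^sup>2)"
proof (cases "t = 0")
  case True
  then show ?thesis by simp
next
  case False
  define I c where "I = (LBINT s:{0..t}. u s)" and "c = I / t"
  have i: "set_integrable lborel {0..t} (\<lambda>s. 2 * c * u s)" using u by auto
  have "0 \<le> (LBINT s:{0..t}. (u s - c)\<^sup>2)"
    unfolding set_lebesgue_integral_def by (rule Bochner_Integration.integral_nonneg) simp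
  also have "(LBINT s:{0..t}. (u s - c)\<^sup>2) = (LBINT s:{0..t}. (u s)\<^sup>2 - 2 * c * u s + c\<^sup>2)"
    by (simp add: power2_diff algebra_simps)
  also have "\<dots> = (LBINT s:{0..t}. (u s)\<^sup>2) - 2 * c * I + c\<^sup>2 * t"
    using u2 u i set_integrable_const_Icc[of 0 t "c\<^sup>2"] t
    by (simp add: set_integral_add set_integral_diff I_def)
      (simp add: set_lebesgue_integral_def)
  finally have "0 \<le> t * ((LBINT s:{0..t}. (u s)\<^sup>2) - 2 * c * I + c\<^sup>2 * t)"
    using t by simp
  also have "\<dots> = t * (LBINT s:{0..t}. (u s)\<^sup>2) - I\<^sup>2"
    using False by (simp add: c_def power2_eq_square field_simps)
  finally show ?thesis by (simp add: I_def)
qed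

text \<open>Integration by parts via Tonelli on the triangle \<open>t \<le> s\<close>: after
  swapping, the inner integral is the Stieltjes mass of \<open>{0..s}\<close>.\<close>

lemma nn_integral_stieltjes_measure:
  assumes "0 \<le> T" and cont: "continuous_on {0..T} g" and mono: "mono_on {0..T} g"
    and [measurable]: "q \<in> borel_measurable borel"
  shows "(\<integral>\<^sup>+t\<in>{0..T}. (\<integral>\<^sup>+s\<in>{t..T}. q s \<partial>lborel) \<partial>stieltjes_measure T g) =
    (\<integral>\<^sup>+s\<in>{0..T}. q s * ennreal (g s - g 0) \<partial>lborel)"
proof -
  define G where "G = (\<lambda>t. g (max 0 (min T t)))"
  have mG: "G x \<le> G y" if "x \<le> y" for x y
    unfolding G_def by (rule mono_onD[OF mono]) (use that \<open>0 \<le> T\<close> in auto)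
  have cG: "continuous_on UNIV G"
    unfolding G_def by (rule continuous_on_compose2[OF cont]) (use \<open>0 \<le> T\<close> in \<open>auto intro!: continuous_intros\<close>)
  have cG': "continuous (at_right a) G" for a
    using cG continuous_at_imp_continuous_at_within continuous_on_eq_continuous_at open_UNIV by blast
  interpret S: sigma_finite_measure "interval_measure G"
    by (rule sigma_finite_interval_measure) (use mG cG' in auto)
  interpret PS: pair_sigma_finite "interval_measure G" lborel ..
  have em: "emeasure (interval_measure G) {0..s} = ennreal (g s - g 0)" if "s \<in> {0..T}" for s
    using that mG cG \<open>0 \<le> T\<close> by (subst emeasure_interval_measure_Icc) (auto simp: G_def)
  let ?f = "\<lambda>(t, s). q s * indicator {t..T} s * indicator {0..T} t"
  have [measurable]: "?f \<in> borel_measurable (interval_measure G \<Otimes>\<^sub>M lborel)"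
    by (auto simp: indicator_def)
  have "(\<integral>\<^sup>+t\<in>{0..T}. (\<integral>\<^sup>+s\<in>{t..T}. q s \<partial>lborel) \<partial>stieltjes_measure T g)
      = (\<integral>\<^sup>+t. (\<integral>\<^sup>+s. ?f (t, s) \<partial>lborel) \<partial>interval_measure G)"
    unfolding stieltjes_measure_def G_def[symmetric]
    by (intro nn_integral_cong) (simp add: nn_integral_multc)
  also have "\<dots> = (\<integral>\<^sup>+s. (\<integral>\<^sup>+t. ?f (t, s) \<partial>interval_measure G) \<partial>lborel)"
    by (rule PS.Fubini'[symmetric]) simp
  also have "\<dots> = (\<integral>\<^sup>+s\<in>{0..T}. q s * ennreal (g s - g 0) \<partial>lborel)"
  proof (rule nn_integral_cong)
    fix s
    have "(\<integral>\<^sup>+t. ?f (t, s) \<partial>interval_measure G) = (\<integral>\<^sup>+t. (q s * indicator {0..T} s) * indicator {0..s} t \<partial>interval_measure G)"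
      by (rule nn_integral_cong) (auto split: split_indicator)
    also have "\<dots> = q s * indicator {0..T} s * emeasure (interval_measure G) {0..s}"
      by (simp add: nn_integral_cmult)
    finally show "(\<integral>\<^sup>+t. ?f (t, s) \<partial>interval_measure G) = q s * ennreal (g s - g 0) * indicator {0..T} s"
      using em[of s] by (auto split: split_indicator)
  qed
  finally show ?thesis .
qed

subsection \<open>Progressive measurability\<close>

lemma progressively_measurableD:
  assumes "progressively_measurable T F u" "t \<in> {0..T}"
  shows "(\<lambda>(s, \<omega>). u s \<omega>) \<in> borel_measurable (restrict_space borel {0..t} \<Otimes>\<^sub>M F t)"
  using assms by (simp add: progressively_measurable_def)

lemma progressively_measurable_adapted:
  assumes "progressively_measurable T F u" "t \<in> {0..T}"
  shows "u t \<in> borel_measurable (F t)"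
proof -
  have "(\<lambda>\<omega>. (t, \<omega>)) \<in> F t \<rightarrow>\<^sub>M restrict_space borel {0..t} \<Otimes>\<^sub>M F t"
    using assms by (intro measurable_Pair1') (auto simp: space_restrict_space)
  from measurable_compose[OF this progressively_measurableD[OF assms]] show ?thesis by simp
qed

lemma progressively_measurable_borel:
  assumes "f \<in> borel_measurable borel"
  shows "progressively_measurable T F (\<lambda>t \<omega>. f t)"
  unfolding progressively_measurable_def split_beta
  by (intro ballI measurable_compose[OF measurable_fst] measurable_restrict_space1 assms)

lemma progressively_measurable_comp2:
  assumes "progressively_measurable T F u" "progressively_measurable T F v"
    and h: "(\<lambda>(a, b). h a b) \<in> borel_measurable (borel \<Otimes>\<^sub>M borel)"
  shows "progressively_measurable T F (\<lambda>t \<omega>. h (u t \<omega>) (v t \<omega>))"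
  unfolding progressively_measurable_def
proof
  fix t assume t: "t \<in> {0..T}"
  have "(\<lambda>x. (case x of (s, \<omega>) \<Rightarrow> u s \<omega>, case x of (s, \<omega>) \<Rightarrow> v s \<omega>))
      \<in> restrict_space borel {0..t} \<Otimes>\<^sub>M F t \<rightarrow>\<^sub>M borel \<Otimes>\<^sub>M borel"
    using progressively_measurableD[OF assms(1) t] progressively_measurableD[OF assms(2) t] by measurable
  from measurable_compose[OF this h]
  show "(\<lambda>(s, \<omega>). h (u s \<omega>) (v s \<omega>)) \<in> borel_measurable (restrict_space borel {0..t} \<Otimes>\<^sub>M F t)"
    by (simp add: split_beta)
qed

lemma progressively_measurable_diff:
  "progressively_measurable T F u \<Longrightarrow> progressively_measurable T F v \<Longrightarrow>
    progressively_measurable T F (\<lambda>t \<omega>. u t \<omega> - v t \<omega> :: real)"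
  by (rule progressively_measurable_comp2) auto

lemma progressively_measurable_mult:
  "progressively_measurable T F u \<Longrightarrow> progressively_measurable T F v \<Longrightarrow>
    progressively_measurable T F (\<lambda>t \<omega>. u t \<omega> * v t \<omega> :: real)"
  by (rule progressively_measurable_comp2) auto

text \<open>The variable upper limit is moved into an indicator that is jointly measurable in both
  times. This leaves a parameter integral over the fixed interval \<open>[0,t]\<close>, which sees
  \<open>u\<close> only up to time \<open>t\<close> and is therefore measurable for
  \<open>F t\<close>.\<close>

lemma progressively_measurable_integral:
  assumes "progressively_measurable T F u"
  shows "progressively_measurable T F (controlled_state x u)"
  unfolding progressively_measurable_def
proof
  fix t assume t: "t \<in> {0..T}"
  let ?R = "restrict_space lborel {0..t}" and ?K = "restrict_space borel {0..t} \<Otimes>\<^sub>M F t"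
  interpret R: sigma_finite_measure ?R
    by (rule sigma_finite_measure_restrict_space) (auto intro: lborel.sigma_finite_measure_axioms)
  have [measurable_cong]: "sets ?R = sets (restrict_space borel {0..t})"
    by (intro sets_restrict_space_cong) simp
  have [measurable]: "(\<lambda>(s, \<omega>). u s \<omega>) \<in> borel_measurable ?K"
    by (rule progressively_measurableD[OF assms t])
  have "(\<lambda>y. (snd y, snd (fst y))) \<in> ?K \<Otimes>\<^sub>M ?R \<rightarrow>\<^sub>M ?K"
    by measurable
  from measurable_compose[OF this progressively_measurableD[OF assms t]]
  have [measurable]: "(\<lambda>y. u (snd y) (snd (fst y))) \<in> borel_measurable (?K \<Otimes>\<^sub>M ?R)" by simp
  have [measurable]: "(\<lambda>y. snd y) \<in> ?K \<Otimes>\<^sub>M ?R \<rightarrow>\<^sub>M borel"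
    "(\<lambda>y. fst (fst y)) \<in> ?K \<Otimes>\<^sub>M ?R \<rightarrow>\<^sub>M borel"
    by (auto intro!: measurable_compose[OF measurable_snd] measurable_compose[OF measurable_fst]
        measurable_restrict_space1)
  have "(\<lambda>y. indicator {0..fst (fst y)} (snd y) * u (snd y) (snd (fst y))) \<in> borel_measurable (?K \<Otimes>\<^sub>M ?R)"
    unfolding indicator_def atLeastAtMost_iff by measurable
  then have m: "(\<lambda>z. \<integral>r. indicator {0..fst z} r * u r (snd z) \<partial>?R) \<in> borel_measurable ?K"
    by (intro R.borel_measurable_lebesgue_integral) (simp add: split_beta')
  have "(\<integral>r. indicator {0..s} r * u r \<omega> \<partial>?R) = (LBINT r:{0..s}. u r \<omega>)" if "s \<in> {0..t}" for s \<omega>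
    using that unfolding set_lebesgue_integral_def
    by (subst integral_restrict_space) (auto intro!: Bochner_Integration.integral_cong split: split_indicator)
  then show "(\<lambda>(s, \<omega>). controlled_state x u s \<omega>) \<in> borel_measurable ?K"
    unfolding controlled_state_def split_beta
    by (intro borel_measurable_add borel_measurable_const measurable_cong[THEN iffD1, OF _ m])
      (auto simp: space_pair_measure space_restrict_space)
qed

text \<open>The process is a pointwise limit of its samples on the grids of mesh
  \<open>1 / Suc n\<close>. Each sample is jointly measurable because it takes only countably many
  sampling times, all at most \<open>t\<close>.\<close>

lemma progressively_measurable_continuous:
  assumes space: "\<And>t. t \<in> {0..T} \<Longrightarrow> space (F t) = \<Omega>"
    and mono: "\<And>s t. s \<in> {0..T} \<Longrightarrow> t \<in> {0..T} \<Longrightarrow> s \<le> t \<Longrightarrow> sets (F s) \<subseteq> sets (F t)"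
    and adapted: "\<And>t. t \<in> {0..T} \<Longrightarrow> X t \<in> borel_measurable (F t)"
    and cont: "\<And>\<omega>. \<omega> \<in> \<Omega> \<Longrightarrow> continuous_on {0..T} (\<lambda>t. X t \<omega>)"
  shows "progressively_measurable T F X"
  unfolding progressively_measurable_def
proof
  fix t assume t: "t \<in> {0..T}"
  let ?K = "restrict_space borel {0..t} \<Otimes>\<^sub>M F t"
  define g :: "nat \<Rightarrow> real \<Rightarrow> real" where "g n s = real_of_int \<lfloor>real (Suc n) * s\<rfloor> / real (Suc n)" for n s
  \<comment> \<open>Clipping to \<open>[0,t]\<close> matters because the countable composition below
    runs over all integers \<open>i\<close>, and every sampled time must yield an
    \<open>F t\<close>-measurable variable.\<close>
  define Xn where "Xn n z = X (max 0 (min t (g n (fst z)))) (snd z)" for n z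
  have ad: "X s \<in> borel_measurable (F t)" if "s \<in> {0..t}" for s
    using adapted[of s] mono[of s t] space[of s] space[of t] that t
    by (auto simp: measurable_def subset_iff)
  have meas: "Xn n \<in> borel_measurable ?K" for n
    unfolding Xn_def g_def
  proof (rule measurable_compose_countable[where f="\<lambda>i z. X (max 0 (min t (real_of_int i / real (Suc n)))) (snd z)"])
    show "(\<lambda>z. X (max 0 (min t (real_of_int i / real (Suc n)))) (snd z)) \<in> borel_measurable ?K" for i
      using t by (intro measurable_compose[OF measurable_snd] ad) auto
    have "fst \<in> borel_measurable ?K"
      using measurable_compose[OF measurable_fst measurable_restrict_space1[OF measurable_ident]]
      by (simp add: id_def)
    then show "(\<lambda>z. \<lfloor>real (Suc n) * fst z\<rfloor>) \<in> ?K \<rightarrow>\<^sub>M count_space UNIV" by measurable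
  qed
  have lim: "(\<lambda>n. Xn n z) \<longlonglongrightarrow> (case z of (s, \<omega>) \<Rightarrow> X s \<omega>)" if z: "z \<in> space ?K" for z
  proof -
    obtain s \<omega> where zs: "z = (s, \<omega>)" and s: "s \<in> {0..t}" and "\<omega> \<in> \<Omega>"
      using z space[OF t] by (cases z) (auto simp: space_pair_measure space_restrict_space)
    have "\<bar>g n s - s\<bar> \<le> 1 / real (Suc n)" for n
    proof -
      have "\<bar>real_of_int \<lfloor>real (Suc n) * s\<rfloor> - real (Suc n) * s\<bar> / real (Suc n) \<le> 1 / real (Suc n)"
        by (intro divide_right_mono) linarith+
      moreover have "g n s - s = (real_of_int \<lfloor>real (Suc n) * s\<rfloor> - real (Suc n) * s) / real (Suc n)"
        by (simp add: g_def diff_divide_distrib del: of_nat_Suc)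
      ultimately show ?thesis by (simp add: abs_divide del: of_nat_Suc)
    qed
    then have "(\<lambda>n. g n s - s) \<longlonglongrightarrow> 0"
      by (intro Lim_null_comparison[OF _ LIMSEQ_inverse_real_of_nat])
        (auto simp: inverse_eq_divide simp del: of_nat_Suc)
    then have "(\<lambda>n. max 0 (min t (g n s))) \<longlonglongrightarrow> max 0 (min t s)"
      by (intro tendsto_intros) (simp add: LIM_zero_iff)
    then have "(\<lambda>n. max 0 (min t (g n s))) \<longlonglongrightarrow> s" using s by simp
    then show ?thesis
      unfolding Xn_def zs prod.case fst_conv snd_conv
      by (intro continuous_on_tendsto_compose[OF cont[OF \<open>\<omega> \<in> \<Omega>\<close>]]) (use s t in \<open>auto intro!: always_eventually simp: min_le_iff_disj\<close>)
  qed
  show "(\<lambda>(s, \<omega>). X s \<omega>) \<in> borel_measurable ?K"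
    by (rule borel_measurable_LIMSEQ_metric[OF meas lim])
qed

subsection \<open>Martingales and square-integrable processes\<close>

lemma sigma_finite_subalgebra_prob:
  assumes "prob_space P" "subalgebra P G"
  shows "sigma_finite_subalgebra P G"
proof -
  interpret prob_space P by fact
  show ?thesis
    by (intro finite_measure_subalgebra_is_sigma_finite finite_measure_subalgebra.intro
        finite_measure_subalgebra_axioms.intro assms finite_measure_axioms)
qed

text \<open>Conditional expectations do not see null sets. This permits passing to versions of
  \<open>M\<close> and \<open>A\<close> whose paths are regular for every outcome.\<close>

lemma martingale_on_modification:
  assumes P: "prob_space P" and F: "\<And>t. t \<in> {0..T} \<Longrightarrow> subalgebra P (F t)"
    and X: "martingale_on T P F X"
    and Y: "\<And>t. t \<in> {0..T} \<Longrightarrow> Y t \<in> borel_measurable (F t)"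
    and ae: "\<And>t. t \<in> {0..T} \<Longrightarrow> AE \<omega> in P. X t \<omega> = Y t \<omega>"
  shows "martingale_on T P F Y"
  unfolding martingale_on_def
proof (intro conjI ballI impI)
  have X': "X t \<in> borel_measurable P" "Y t \<in> borel_measurable P" if "t \<in> {0..T}" for t
    using X Y[OF that] that measurable_from_subalg[OF F[OF that]] by (auto simp: martingale_on_def)
  show "Y t \<in> borel_measurable (F t)" if "t \<in> {0..T}" for t by (rule Y[OF that])
  show "integrable P (Y t)" if t: "t \<in> {0..T}" for t
    using X t integrable_cong_AE[OF X'[OF t] ae[OF t]] by (auto simp: martingale_on_def)
  show "AE \<omega> in P. real_cond_exp P (F s) (Y t) \<omega> = Y s \<omega>"
    if s: "s \<in> {0..T}" and t: "t \<in> {0..T}" and "s \<le> t" for s t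
  proof -
    interpret S: sigma_finite_subalgebra P "F s"
      by (rule sigma_finite_subalgebra_prob[OF P F[OF s]])
    have "AE \<omega> in P. real_cond_exp P (F s) (X t) \<omega> = X s \<omega>"
      using X s t \<open>s \<le> t\<close> by (auto simp: martingale_on_def)
    with S.real_cond_exp_cong[OF ae[OF t] X'[OF t]] ae[OF s] show ?thesis
      by eventually_elim simp
  qed
qed

text \<open>Taking out what is known at time \<open>t\<close>. Integrability is asked of the product
  at the terminal time, which is what Fubini supplies when \<open>W\<close> is a time section of a
  square-integrable process.\<close>

lemma martingale_on_integral_mult:
  assumes P: "prob_space P" and F: "\<And>t. t \<in> {0..T} \<Longrightarrow> subalgebra P (F t)"
    and X: "martingale_on T P F X" and t: "t \<in> {0..T}"
    and W: "W \<in> borel_measurable (F t)" and i: "integrable P (\<lambda>\<omega>. W \<omega> * X T \<omega>)"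
  shows "(\<integral>\<omega>. W \<omega> * X t \<omega> \<partial>P) = (\<integral>\<omega>. W \<omega> * X T \<omega> \<partial>P)"
proof -
  interpret S: sigma_finite_subalgebra P "F t"
    by (rule sigma_finite_subalgebra_prob[OF P F[OF t]])
  have T: "T \<in> {0..T}" using t by auto
  have XT: "X T \<in> borel_measurable P" and Xt: "X t \<in> borel_measurable P"
    using X t T by (auto simp: martingale_on_def)
  have W': "W \<in> borel_measurable P" by (rule measurable_from_subalg[OF F[OF t] W])
  have "AE \<omega> in P. real_cond_exp P (F t) (X T) \<omega> = X t \<omega>"
    using X t T by (auto simp: martingale_on_def)
  then have "(\<integral>\<omega>. W \<omega> * X t \<omega> \<partial>P) = (\<integral>\<omega>. W \<omega> * real_cond_exp P (F t) (X T) \<omega> \<partial>P)"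
    using W' Xt by (intro integral_cong_AE) auto
  also have "\<dots> = (\<integral>\<omega>. W \<omega> * X T \<omega> \<partial>P)"
    by (rule S.real_cond_exp_intg(2)[OF i W XT])
  finally show ?thesis .
qed

lemma martingale_on_integral:
  assumes P: "prob_space P" and F: "\<And>t. t \<in> {0..T} \<Longrightarrow> subalgebra P (F t)"
    and X: "martingale_on T P F X" and t: "t \<in> {0..T}"
  shows "(\<integral>\<omega>. X t \<omega> \<partial>P) = (\<integral>\<omega>. X 0 \<omega> \<partial>P)"
proof -
  have "T \<in> {0..T}" "0 \<in> {0..T}" using t by auto
  then have "integrable P (X T)" using X by (auto simp: martingale_on_def)
  then have "(\<integral>\<omega>. X s \<omega> \<partial>P) = (\<integral>\<omega>. X T \<omega> \<partial>P)" if "s \<in> {0..T}" for s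
    using martingale_on_integral_mult[OF P F X that, of "\<lambda>_. 1"] by simp
  from this[OF t] this[OF \<open>0 \<in> {0..T}\<close>] show ?thesis by simp
qed

text \<open>The problem after regularization: initial values and path properties of \<open>M\<close>
  and \<open>A\<close> hold on the whole space instead of almost surely, and both processes are
  progressively measurable. The final theorem is reduced to this setting by changing them on one
  null set.\<close>

locale tracking_problem =
  fixes T :: real and P :: "'a measure" and F :: "real \<Rightarrow> 'a measure" and M A :: "real \<Rightarrow> 'a \<Rightarrow> real"
  assumes T_pos: "0 < T"
    and prob: "prob_space P"
    and subalg: "\<And>t. t \<in> {0..T} \<Longrightarrow> subalgebra P (F t)"
    and M_prog: "progressively_measurable T F M"
    and A_prog: "progressively_measurable T F A"
    and M_martingale: "martingale_on T P F M"
    and M2_integrable: "\<And>t. t \<in> {0..T} \<Longrightarrow> integrable P (\<lambda>\<omega>. (M t \<omega>)\<^sup>2)"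
    and M2A_martingale: "martingale_on T P F (\<lambda>t \<omega>. (M t \<omega>)\<^sup>2 - A t \<omega>)"
    and M_0: "\<And>\<omega>. M 0 \<omega> = 0"
    and A_0: "\<And>\<omega>. A 0 \<omega> = 0"
    and A_continuous: "\<And>\<omega>. \<omega> \<in> space P \<Longrightarrow> continuous_on {0..T} (\<lambda>t. A t \<omega>)"
    and A_mono: "\<And>\<omega>. \<omega> \<in> space P \<Longrightarrow> mono_on {0..T} (\<lambda>t. A t \<omega>)"
begin

section \<open>Square-integrable processes on the product of \<open>[0,T]\<close> and the
  probability space\<close>

sublocale prob_space P by (rule prob)

abbreviation R :: "real measure" where "R \<equiv> restrict_space lborel {0..T}"

sublocale R: finite_measure R
  by (rule finite_measureI) (simp add: emeasure_restrict_space space_restrict_space emeasure_lborel_Icc_eq)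

sublocale RP: pair_sigma_finite R P ..

lemma sets_R: "sets R = sets (restrict_space borel {0..T})"
  by (intro sets_restrict_space_cong) simp

lemma space_R: "space R = {0..T}" by (simp add: space_restrict_space)

lemma integral_R: "integral\<^sup>L R f = (LBINT s:{0..T}. f s)" for f :: "real \<Rightarrow> real"
  by (simp add: set_lebesgue_integral_def integral_restrict_space)

lemma integrable_R: "integrable R f \<longleftrightarrow> set_integrable lborel {0..T} f" for f :: "real \<Rightarrow> real"
  by (simp add: set_integrable_def integrable_restrict_space)

lemma nn_integral_R: "integral\<^sup>N R f = (\<integral>\<^sup>+s\<in>{0..T}. f s \<partial>lborel)"
  by (simp add: nn_integral_restrict_space)

lemma T_mem: "T \<in> {0..T}" "0 \<in> {0..T}" using T_pos by auto

lemma prog_measurable_RP: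
  assumes "progressively_measurable T F u"
  shows "case_prod u \<in> borel_measurable (R \<Otimes>\<^sub>M P)"
proof -
  have "(\<lambda>\<omega>. \<omega>) \<in> P \<rightarrow>\<^sub>M F T"
    using subalg[OF T_mem(1)] by (auto simp: measurable_def subalgebra_def)
  then have "(\<lambda>x. (fst x, snd x)) \<in> R \<Otimes>\<^sub>M P \<rightarrow>\<^sub>M restrict_space borel {0..T} \<Otimes>\<^sub>M F T"
    by (intro measurable_Pair measurable_compose[OF measurable_snd])
      (auto simp: measurable_cong_sets[OF refl sets_R[symmetric]])
  from measurable_compose[OF this progressively_measurableD[OF assms T_mem(1)]]
  show ?thesis by (simp add: split_beta')
qed

text \<open>Adaptedness is kept separate, so that the process constantly equal to the terminal value
  \<open>M T\<close> also belongs to this class.\<close>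

definition L2 :: "(real \<Rightarrow> 'a \<Rightarrow> real) \<Rightarrow> bool" where
  "L2 u \<longleftrightarrow> case_prod u \<in> borel_measurable (R \<Otimes>\<^sub>M P) \<and>
     integrable (R \<Otimes>\<^sub>M P) (\<lambda>(t, \<omega>). (u t \<omega>)\<^sup>2)"

lemma L2_measurable: "L2 u \<Longrightarrow> (\<lambda>x. u (fst x) (snd x)) \<in> borel_measurable (R \<Otimes>\<^sub>M P)"
  by (simp add: L2_def split_beta')

lemma L2_mult: "L2 u \<Longrightarrow> L2 v \<Longrightarrow> integrable (R \<Otimes>\<^sub>M P) (\<lambda>(t, \<omega>). u t \<omega> * v t \<omega>)"
proof -
  assume u: "L2 u" and v: "L2 v"
  note [measurable] = L2_measurable[OF u] L2_measurable[OF v]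
  have "integrable (R \<Otimes>\<^sub>M P) (\<lambda>x. (u (fst x) (snd x))\<^sup>2 + (v (fst x) (snd x))\<^sup>2)"
    using u v by (auto simp: L2_def split_beta')
  then show ?thesis
    unfolding split_beta'
  proof (rule Bochner_Integration.integrable_bound, goal_cases)
    case 1 then show ?case by measurable
  next
    case 2
    have "\<bar>a * b\<bar> \<le> \<bar>a\<^sup>2 + b\<^sup>2\<bar>" for a b :: real
      using sum_squares_bound[of "\<bar>a\<bar>" "\<bar>b\<bar>"] mult_nonneg_nonneg[of "\<bar>a\<bar>" "\<bar>b\<bar>"] unfolding abs_mult power2_abs by linarith
    then show ?case unfolding real_norm_def by (intro AE_I2)
  qed
qed

lemma L2_diff: "L2 u \<Longrightarrow> L2 v \<Longrightarrow> L2 (\<lambda>t \<omega>. u t \<omega> - v t \<omega>)"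
proof -
  assume u: "L2 u" and v: "L2 v"
  note [measurable] = L2_measurable[OF u] L2_measurable[OF v]
  have "integrable (R \<Otimes>\<^sub>M P) (\<lambda>x. (u (fst x) (snd x))\<^sup>2 + (v (fst x) (snd x))\<^sup>2 - 2 * (u (fst x) (snd x) * v (fst x) (snd x)))"
    using u v L2_mult[OF u v] by (auto simp: L2_def split_beta')
  then show ?thesis
    unfolding L2_def split_beta' power2_diff by (auto simp: mult.assoc)
qed

lemma continuous_bounded_Icc:
  assumes "continuous_on UNIV (p :: real \<Rightarrow> real)"
  obtains C where "\<And>t. t \<in> {0..T} \<Longrightarrow> \<bar>p t\<bar> \<le> C" "0 \<le> C"
proof -
  have "compact (p ` {0..T})"
    using assms by (intro compact_continuous_image) (auto intro: continuous_on_subset)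
  from compact_imp_bounded[OF this] obtain C where C: "\<forall>t\<in>{0..T}. \<bar>p t\<bar> \<le> C"
    by (auto simp: bounded_iff)
  with T_mem(2) have "0 \<le> C" by force
  with C that show ?thesis by blast
qed

lemma L2_cmult:
  assumes p: "continuous_on UNIV p" and u: "L2 u"
  shows "L2 (\<lambda>t \<omega>. p t * u t \<omega>)"
proof -
  note [measurable] = L2_measurable[OF u]
  have [measurable]: "(\<lambda>x. p (fst x)) \<in> borel_measurable (R \<Otimes>\<^sub>M P)"
    using borel_measurable_continuous_onI[OF p]
    by (intro measurable_compose[OF measurable_fst] measurable_restrict_space1) simp
  obtain C where C: "\<And>t. t \<in> {0..T} \<Longrightarrow> \<bar>p t\<bar> \<le> C" "0 \<le> C" using continuous_bounded_Icc[OF p] by blast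
  have "integrable (R \<Otimes>\<^sub>M P) (\<lambda>x. C\<^sup>2 * (u (fst x) (snd x))\<^sup>2)"
    using u by (auto simp: L2_def split_beta')
  then have "integrable (R \<Otimes>\<^sub>M P) (\<lambda>x. (p (fst x) * u (fst x) (snd x))\<^sup>2)"
  proof (rule Bochner_Integration.integrable_bound)
    have "(p t * y)\<^sup>2 \<le> C\<^sup>2 * y\<^sup>2" if "t \<in> {0..T}" for t y
      unfolding power_mult_distrib using C(1)[OF that] C(2)
      by (intro mult_right_mono) (auto simp: abs_le_square_iff[symmetric])
    then show "AE x in R \<Otimes>\<^sub>M P. norm ((p (fst x) * u (fst x) (snd x))\<^sup>2) \<le> norm (C\<^sup>2 * (u (fst x) (snd x))\<^sup>2)"
      by (intro AE_I2) (auto simp: space_pair_measure space_R)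
  qed measurable
  then show ?thesis unfolding L2_def split_beta' by auto
qed

lemma L2_iff_nn_integral:
  assumes "case_prod u \<in> borel_measurable (R \<Otimes>\<^sub>M P)"
  shows "L2 u \<longleftrightarrow> (\<integral>\<^sup>+\<omega>. (\<integral>\<^sup>+t\<in>{0..T}. ennreal ((u t \<omega>)\<^sup>2) \<partial>lborel) \<partial>P) < \<infinity>"
proof -
  have [measurable]: "(\<lambda>x. u (fst x) (snd x)) \<in> borel_measurable (R \<Otimes>\<^sub>M P)"
    using assms by (simp add: split_beta')
  have "(\<integral>\<^sup>+\<omega>. (\<integral>\<^sup>+t\<in>{0..T}. ennreal ((u t \<omega>)\<^sup>2) \<partial>lborel) \<partial>P)
      = (\<integral>\<^sup>+x. ennreal ((u (fst x) (snd x))\<^sup>2) \<partial>(R \<Otimes>\<^sub>M P))"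
    by (subst RP.nn_integral_snd[symmetric]) (auto simp: nn_integral_R)
  then show ?thesis
    by (simp add: L2_def assms split_beta' integrable_iff_bounded)
qed

lemma controls_iff: "u \<in> controls T P F \<longleftrightarrow> progressively_measurable T F u \<and> L2 u"
  using L2_iff_nn_integral[OF prog_measurable_RP] by (auto simp: controls_def)

lemma A_nonneg: "0 \<le> A t \<omega>" and A_le: "A t \<omega> \<le> A T \<omega>" if "t \<in> {0..T}" "\<omega> \<in> space P" for t \<omega>
  using mono_onD[OF A_mono[OF that(2)], of 0 t] mono_onD[OF A_mono[OF that(2)], of t T] that A_0 by auto

lemma A_integrable: "integrable P (A t)" if "t \<in> {0..T}" for t
  using Bochner_Integration.integrable_diff[OF M2_integrable[OF that], of "\<lambda>\<omega>. (M t \<omega>)\<^sup>2 - A t \<omega>"] M2A_martingale that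
  by (simp add: martingale_on_def)

lemma expectation_M2: "(\<integral>\<omega>. (M t \<omega>)\<^sup>2 \<partial>P) = (\<integral>\<omega>. A t \<omega> \<partial>P)" if "t \<in> {0..T}" for t
  using martingale_on_integral[OF prob subalg M2A_martingale that] M2_integrable[OF that] A_integrable[OF that]
  by (simp add: M_0 A_0)

text \<open>The second moment of \<open>M t\<close> is the mean of \<open>A t\<close>, hence at most
  the mean of \<open>A T\<close>; this uniform bound is integrated over an interval of finite
  length.\<close>

lemma M_L2: "L2 M" and M_T_L2: "L2 (\<lambda>t. M T)"
proof -
  have m: "(\<lambda>x. M (fst x) (snd x)) \<in> borel_measurable (R \<Otimes>\<^sub>M P)"
    using prog_measurable_RP[OF M_prog] by (simp add: split_beta')
  have e: "(\<integral>\<^sup>+\<omega>. ennreal ((M t \<omega>)\<^sup>2) \<partial>P) \<le> ennreal (\<integral>\<omega>. A T \<omega> \<partial>P)" if "t \<in> {0..T}" for t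
    unfolding nn_integral_eq_integral[OF M2_integrable[OF that] AE_I2[OF zero_le_power2]] expectation_M2[OF that]
    by (intro ennreal_leI integral_mono A_integrable that T_mem A_le)
  have fin: "(\<integral>\<^sup>+x. ennreal (\<integral>\<omega>. A T \<omega> \<partial>P) \<partial>R) < \<infinity>"
    using R.emeasure_finite[of "{0..T}"] by (simp add: space_R ennreal_mult_eq_top_iff less_top[symmetric])
  have "(\<integral>\<^sup>+x. ennreal ((M (fst x) (snd x))\<^sup>2) \<partial>(R \<Otimes>\<^sub>M P)) = (\<integral>\<^sup>+t. (\<integral>\<^sup>+\<omega>. ennreal ((M t \<omega>)\<^sup>2) \<partial>P) \<partial>R)"
    using m by (subst nn_integral_fst[symmetric]) auto
  also have "\<dots> \<le> (\<integral>\<^sup>+x. ennreal (\<integral>\<omega>. A T \<omega> \<partial>P) \<partial>R)"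
    by (intro nn_integral_mono e) (simp add: space_R)
  finally show "L2 M" using m fin
    by (simp add: L2_def split_beta' integrable_iff_bounded le_less_trans)
  have "M T \<in> borel_measurable P"
    using M_martingale T_mem by (auto simp: martingale_on_def)
  then have m: "(\<lambda>x. M T (snd x)) \<in> borel_measurable (R \<Otimes>\<^sub>M P)" by measurable
  have "(\<integral>\<^sup>+x. ennreal ((M T (snd x))\<^sup>2) \<partial>(R \<Otimes>\<^sub>M P)) = (\<integral>\<^sup>+t. (\<integral>\<^sup>+\<omega>. ennreal ((M T \<omega>)\<^sup>2) \<partial>P) \<partial>R)"
    using m by (subst nn_integral_fst[symmetric]) auto
  also have "\<dots> \<le> (\<integral>\<^sup>+x. ennreal (\<integral>\<omega>. A T \<omega> \<partial>P) \<partial>R)"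
    by (intro nn_integral_mono e T_mem)
  finally show "L2 (\<lambda>t. M T)" using m fin
    by (simp add: L2_def split_beta' integrable_iff_bounded le_less_trans)
qed

text \<open>Fubini gives almost surely square-integrable paths, and on a bounded interval these are
  integrable. Thus the Lebesgue integral in \<open>controlled_state\<close> is proper almost
  surely.\<close>

lemma L2_AE_path:
  assumes "L2 u"
  shows "AE \<omega> in P. set_integrable lborel {0..T} (\<lambda>t. u t \<omega>) \<and> set_integrable lborel {0..T} (\<lambda>t. (u t \<omega>)\<^sup>2)"
proof -
  have m: "case_prod u \<in> borel_measurable (R \<Otimes>\<^sub>M P)"
    and i: "integrable (R \<Otimes>\<^sub>M P) (case_prod (\<lambda>t \<omega>. (u t \<omega>)\<^sup>2))"
    using assms by (auto simp: L2_def)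
  have "set_borel_measurable lborel {0..T} (\<lambda>t. u t \<omega>)" if "\<omega> \<in> space P" for \<omega>
    unfolding set_borel_measurable_def
    using measurable_compose[OF measurable_Pair2' m, OF that]
    by (subst borel_measurable_restrict_space_iff[symmetric]) auto
  with AE_space RP.AE_integrable_snd[OF i] show ?thesis
    by (auto simp: integrable_R intro: set_integrable_of_power2)
qed

text \<open>By Cauchy-Schwarz the squared state is at most \<open>2 * z\<^sup>2\<close> plus
  \<open>2 * T\<close> times the energy of the path of \<open>u\<close>, uniformly in time.
  Integrating over time and outcomes keeps this finite.\<close>

lemma controlled_state_L2:
  assumes prog: "progressively_measurable T F u" and u: "L2 u"
  shows "L2 (controlled_state z u)"
proof -
  note m = prog_measurable_RP[OF progressively_measurable_integral[OF prog]]
  let ?I = "\<lambda>\<omega>. \<integral>\<^sup>+s\<in>{0..T}. ennreal ((u s \<omega>)\<^sup>2) \<partial>lborel"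
  have fin: "(\<integral>\<^sup>+\<omega>. ?I \<omega> \<partial>P) < \<infinity>"
    using u L2_iff_nn_integral[OF prog_measurable_RP[OF prog]] by simp
  have [measurable]: "?I \<in> borel_measurable P"
  proof -
    have [measurable]: "(\<lambda>(\<omega>, t). ennreal ((u t \<omega>)\<^sup>2)) \<in> borel_measurable (P \<Otimes>\<^sub>M R)"
      using measurable_compose[OF measurable_pair_swap' prog_measurable_RP[OF prog]]
      by (simp add: split_beta')
    show ?thesis unfolding nn_integral_R[symmetric] by measurable
  qed
  have "AE \<omega> in P. (\<integral>\<^sup>+t\<in>{0..T}. ennreal ((controlled_state z u t \<omega>)\<^sup>2) \<partial>lborel)
      \<le> ennreal T * (ennreal (2 * z\<^sup>2) + ennreal (2 * T) * ?I \<omega>)"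
    using L2_AE_path[OF u]
  proof eventually_elim
    case (elim \<omega>)
    let ?J = "LBINT s:{0..T}. (u s \<omega>)\<^sup>2"
    have J: "?I \<omega> = ennreal ?J"
      unfolding set_lebesgue_integral_def using elim
      by (subst nn_integral_eq_integral[symmetric])
        (auto simp: set_integrable_def intro!: nn_integral_cong split: split_indicator)
    have J0: "0 \<le> ?J" by (simp add: set_lebesgue_integral_def)
    have le: "(controlled_state z u t \<omega>)\<^sup>2 \<le> 2 * z\<^sup>2 + 2 * T * ?J" if t: "t \<in> {0..T}" for t
    proof -
      have i: "set_integrable lborel {0..t} (\<lambda>t. u t \<omega>)" "set_integrable lborel {0..t} (\<lambda>t. (u t \<omega>)\<^sup>2)"
        using elim t by (auto intro: set_integrable_subset)
      have "(LBINT s:{0..t}. u s \<omega>)\<^sup>2 \<le> t * (LBINT s:{0..t}. (u s \<omega>)\<^sup>2)"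
        using t i by (intro set_integral_power2_le) auto
      also have "(LBINT s:{0..t}. (u s \<omega>)\<^sup>2) \<le> ?J"
        unfolding set_lebesgue_integral_def using elim i t
        by (intro integral_mono) (auto simp: set_integrable_def split: split_indicator)
      then have "t * (LBINT s:{0..t}. (u s \<omega>)\<^sup>2) \<le> T * ?J"
        using t J0 by (intro mult_mono) (auto simp: set_lebesgue_integral_def)
      finally have "2 * (LBINT s:{0..t}. u s \<omega>)\<^sup>2 \<le> 2 * T * ?J" by simp
      moreover have "(a + b)\<^sup>2 \<le> 2 * a\<^sup>2 + 2 * b\<^sup>2" for a b :: real
        using zero_le_power2[of "a - b"] unfolding power2_diff power2_sum by linarith
      from this[of z "LBINT s:{0..t}. u s \<omega>"]
      have "(controlled_state z u t \<omega>)\<^sup>2 \<le> 2 * z\<^sup>2 + 2 * (LBINT s:{0..t}. u s \<omega>)\<^sup>2"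
        unfolding controlled_state_def .
      ultimately show ?thesis by linarith
    qed
    have "(\<integral>\<^sup>+t\<in>{0..T}. ennreal ((controlled_state z u t \<omega>)\<^sup>2) \<partial>lborel)
        \<le> (\<integral>\<^sup>+t. ennreal (2 * z\<^sup>2 + 2 * T * ?J) * indicator {0..T} t \<partial>lborel)"
      by (intro nn_integral_mono) (auto intro!: ennreal_leI le split: split_indicator)
    also have "\<dots> = ennreal T * (ennreal (2 * z\<^sup>2) + ennreal (2 * T) * ?I \<omega>)"
      unfolding J using J0 T_pos
      by (subst nn_integral_cmult_indicator) (simp_all add: ennreal_mult[symmetric] ennreal_plus[symmetric] mult.commute del: ennreal_plus)
    finally show ?case .
  qed
  then have "(\<integral>\<^sup>+\<omega>. (\<integral>\<^sup>+t\<in>{0..T}. ennreal ((controlled_state z u t \<omega>)\<^sup>2) \<partial>lborel) \<partial>P)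
      \<le> (\<integral>\<^sup>+\<omega>. ennreal T * (ennreal (2 * z\<^sup>2) + ennreal (2 * T) * ?I \<omega>) \<partial>P)"
    by (rule nn_integral_mono_AE)
  also have "\<dots> = ennreal T * (ennreal (2 * z\<^sup>2) + ennreal (2 * T) * (\<integral>\<^sup>+\<omega>. ?I \<omega> \<partial>P))"
    by (simp add: nn_integral_cmult nn_integral_add emeasure_space_1)
  also have "\<dots> < \<infinity>" using fin by (simp add: ennreal_mult_less_top less_top)
  finally show ?thesis unfolding L2_iff_nn_integral[OF m] .
qed

end

subsection \<open>The cost identity\<close>

text \<open>With \<open>k = sqrt \<kappa>\<close> this solves the Riccati equation of the
  linear-quadratic tracking problem with terminal value 0; half of it is the quadratic coefficient
  of the value.\<close>

definition riccati :: "real \<Rightarrow> real \<Rightarrow> real \<Rightarrow> real" where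
  "riccati T k t = k * tanh ((T - t) / k)"

definition riccati_rate :: "real \<Rightarrow> real \<Rightarrow> real \<Rightarrow> real" where
  "riccati_rate T k t = 1 - (tanh ((T - t) / k))\<^sup>2"

lemma riccati_DERIV: "k > 0 \<Longrightarrow> (riccati T k has_real_derivative - riccati_rate T k t) (at t)"
  unfolding riccati_def[abs_def] riccati_rate_def
  by (auto intro!: derivative_eq_intros simp: power2_eq_square)

lemma riccati_end [simp]: "riccati T k T = 0" by (simp add: riccati_def)

lemma riccati_rate_bounds: "0 \<le> riccati_rate T k t" "riccati_rate T k t \<le> 1"
  using tanh_real_bounds[of "(T - t) / k"] by (auto simp: riccati_rate_def abs_square_le_1 abs_if)

lemma riccati_rate_eq: "k > 0 \<Longrightarrow> riccati_rate T k t = 1 - (riccati T k t)\<^sup>2 / k\<^sup>2"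
  by (simp add: riccati_def riccati_rate_def power_mult_distrib)

lemma riccati_continuous:
  assumes "k > 0"
  shows "continuous_on UNIV (riccati T k)" "continuous_on UNIV (riccati_rate T k)"
  unfolding riccati_def[abs_def] riccati_rate_def[abs_def] using assms by (auto intro!: continuous_intros)

lemma riccati_primitive: "k > 0 \<Longrightarrow> primitive_on T (riccati T k) (\<lambda>t. - riccati_rate T k t)"
  using riccati_continuous(2)
  by (intro primitive_on_FTC riccati_DERIV) (auto simp: continuous_on_eq_continuous_at)

text \<open>Completing the square; with \<open>p' = - q\<close> and \<open>z' = u\<close> the last two lines are the derivatives
  of \<open>- p z\<^sup>2 / 2\<close> and of \<open>p z\<close> times \<open>m\<close>.\<close>
lemma riccati_square:
  fixes k z m u p q :: real
  assumes "k > 0" "q = 1 - p\<^sup>2 / k\<^sup>2"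
  shows "(z - m)\<^sup>2 / 2 + k\<^sup>2 / 2 * u\<^sup>2 =
    k\<^sup>2 / 2 * (u + p * (z - m) / k\<^sup>2)\<^sup>2 + q * m\<^sup>2 / 2
    + (q * z\<^sup>2 / 2 - p * u * z)
    + (p * u - q * z) * m"
  unfolding assms(2) using assms(1) by (simp add: power2_eq_square field_simps)

text \<open>Both integrands are exact derivatives, of \<open>p Z\<close> and of
  \<open>- p Z\<^sup>2 / 2\<close>. The boundary term at \<open>T\<close> vanishes with
  \<open>p\<close>, so only the initial state enters and the control drops out.\<close>

lemma riccati_path:
  assumes "0 \<le> T" "k > 0" and Z: "primitive_on T Z u"
  shows "(LBINT t:{0..T}. riccati T k t * u t - riccati_rate T k t * Z t) = - riccati T k 0 * Z 0"
    and "(LBINT t:{0..T}. riccati_rate T k t * (Z t)\<^sup>2 / 2 - riccati T k t * u t * Z t) = riccati T k 0 * (Z 0)\<^sup>2 / 2"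
proof -
  have T: "T \<in> {0..T}" using \<open>0 \<le> T\<close> by auto
  note p = riccati_primitive[OF \<open>k > 0\<close>, of T]
  from primitive_onD(2)[OF primitive_on_mult[OF p Z] T]
  show "(LBINT t:{0..T}. riccati T k t * u t - riccati_rate T k t * Z t) = - riccati T k 0 * Z 0"
    by (simp add: algebra_simps)
  have "primitive_on T (\<lambda>t. riccati T k t * (Z t * Z t))
      (\<lambda>t. - riccati_rate T k t * (Z t * Z t) + riccati T k t * (u t * Z t + Z t * u t))"
    by (intro primitive_on_mult p Z)
  from primitive_onD(2)[OF this T]
  have "(LBINT t:{0..T}. - riccati_rate T k t * (Z t * Z t) + riccati T k t * (u t * Z t + Z t * u t))
      = - riccati T k 0 * (Z 0)\<^sup>2"
    by (simp add: power2_eq_square)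
  moreover have "(LBINT t:{0..T}. riccati_rate T k t * (Z t)\<^sup>2 / 2 - riccati T k t * u t * Z t)
     = (LBINT t:{0..T}. (- 1/2) * (- riccati_rate T k t * (Z t * Z t) + riccati T k t * (u t * Z t + Z t * u t)))"
    by (intro arg_cong[of _ _ "set_lebesgue_integral lborel {0..T}"] ext) (simp add: power2_eq_square field_simps)
  ultimately show "(LBINT t:{0..T}. riccati_rate T k t * (Z t)\<^sup>2 / 2 - riccati T k t * u t * Z t) = riccati T k 0 * (Z 0)\<^sup>2 / 2"
    by (simp only: set_integral_mult_right)
qed

context tracking_problem
begin

text \<open>Twice the part of the cost that no control can remove. The form with the mean of
  \<open>A\<close> is what the second moment of \<open>M\<close> produces directly;
  \<open>noise_cost_stieltjes\<close> identifies it with the integral of \<open>riccati\<close>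
  against \<open>A\<close>.\<close>

definition noise_cost :: "real \<Rightarrow> real" where
  "noise_cost k = (LBINT t:{0..T}. riccati_rate T k t * (\<integral>\<omega>. A t \<omega> \<partial>P))"

lemma controlled_state_primitive:
  assumes "L2 u"
  shows "AE \<omega> in P. primitive_on T (\<lambda>t. controlled_state z u t \<omega>) (\<lambda>t. u t \<omega>)"
  using L2_AE_path[OF assms] unfolding controlled_state_def
  by eventually_elim (simp add: primitive_on_integral)

lemma integral_rate_M2:
  assumes "k > 0"
  shows "integrable (R \<Otimes>\<^sub>M P) (\<lambda>(t, \<omega>). riccati_rate T k t * (M t \<omega>)\<^sup>2)"
    and "integral\<^sup>L (R \<Otimes>\<^sub>M P) (\<lambda>(t, \<omega>). riccati_rate T k t * (M t \<omega>)\<^sup>2) = noise_cost k"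
proof -
  note c = riccati_continuous(2)[OF assms, of T]
  show i: "integrable (R \<Otimes>\<^sub>M P) (\<lambda>(t, \<omega>). riccati_rate T k t * (M t \<omega>)\<^sup>2)"
    using L2_mult[OF L2_cmult[OF c M_L2] M_L2] by (simp add: power2_eq_square mult.assoc)
  have "integral\<^sup>L (R \<Otimes>\<^sub>M P) (\<lambda>(t, \<omega>). riccati_rate T k t * (M t \<omega>)\<^sup>2)
      = (\<integral>t. (\<integral>\<omega>. riccati_rate T k t * (M t \<omega>)\<^sup>2 \<partial>P) \<partial>R)"
    by (rule RP.integral_fst[OF i, symmetric])
  also have "\<dots> = noise_cost k"
    unfolding noise_cost_def integral_R[symmetric]
    by (rule Bochner_Integration.integral_cong) (simp_all add: expectation_M2 space_R)
  finally show "integral\<^sup>L (R \<Otimes>\<^sub>M P) (\<lambda>(t, \<omega>). riccati_rate T k t * (M t \<omega>)\<^sup>2) = noise_cost k" .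
qed

text \<open>The martingale property lets \<open>M t\<close> be replaced by \<open>M T\<close>, which no longer depends on the
  time integral; this is what makes stochastic integration unnecessary.\<close>
lemma integral_mult_M_eq_0:
  assumes prog: "progressively_measurable T F w" and w: "L2 w"
    and const: "AE \<omega> in P. (LBINT t:{0..T}. w t \<omega>) = c"
  shows "integral\<^sup>L (R \<Otimes>\<^sub>M P) (\<lambda>(t, \<omega>). w t \<omega> * M t \<omega>) = 0"
proof -
  note i = L2_mult[OF w M_L2] and iT = L2_mult[OF w M_T_L2]
  have m: "case_prod w \<in> borel_measurable (R \<Otimes>\<^sub>M P)" using w by (simp add: L2_def)
  have "integral\<^sup>L (R \<Otimes>\<^sub>M P) (\<lambda>(t, \<omega>). w t \<omega> * M t \<omega>) = (\<integral>t. (\<integral>\<omega>. w t \<omega> * M t \<omega> \<partial>P) \<partial>R)"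
    by (rule RP.integral_fst[OF i, symmetric])
  also have "\<dots> = (\<integral>t. (\<integral>\<omega>. w t \<omega> * M T \<omega> \<partial>P) \<partial>R)"
  proof (rule integral_cong_AE)
    show "(\<lambda>t. \<integral>\<omega>. w t \<omega> * M t \<omega> \<partial>P) \<in> borel_measurable R"
      "(\<lambda>t. \<integral>\<omega>. w t \<omega> * M T \<omega> \<partial>P) \<in> borel_measurable R"
      using RP.integrable_fst[OF i] RP.integrable_fst[OF iT] by auto
    \<comment> \<open>The martingale identity needs \<open>w t\<close> times \<open>M T\<close> to
      be integrable at the fixed time \<open>t\<close>; Fubini guarantees this for almost every
      \<open>t\<close>.\<close>
    show "AE t in R. (\<integral>\<omega>. w t \<omega> * M t \<omega> \<partial>P) = (\<integral>\<omega>. w t \<omega> * M T \<omega> \<partial>P)"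
      using RP.AE_integrable_fst[OF iT] AE_space
    proof eventually_elim
      case (elim t)
      then show ?case
        by (intro martingale_on_integral_mult[OF prob subalg M_martingale]
            progressively_measurable_adapted[OF prog]) (auto simp: space_R)
    qed
  qed
  \<comment> \<open>With time now integrated innermost, \<open>M T\<close> is a constant factor and
    the time integral of \<open>w\<close> is the deterministic \<open>c\<close>.\<close>
  also have "\<dots> = (\<integral>\<omega>. (\<integral>t. w t \<omega> * M T \<omega> \<partial>R) \<partial>P)"
    by (rule RP.Fubini_integral[OF iT, symmetric])
  also have "\<dots> = (\<integral>\<omega>. c * M T \<omega> \<partial>P)"
  proof (rule integral_cong_AE)
    show "(\<lambda>\<omega>. \<integral>t. w t \<omega> * M T \<omega> \<partial>R) \<in> borel_measurable P"
      using RP.integrable_snd[OF iT] by auto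
    have "integrable P (M T)" using M_martingale T_mem by (auto simp: martingale_on_def)
    then show "(\<lambda>\<omega>. c * M T \<omega>) \<in> borel_measurable P" by measurable
    show "AE \<omega> in P. (\<integral>t. w t \<omega> * M T \<omega> \<partial>R) = c * M T \<omega>"
      using const by eventually_elim (simp add: integral_R[symmetric])
  qed
  also have "\<dots> = 0"
    using martingale_on_integral[OF prob subalg M_martingale T_mem(1)] by (simp add: M_0)
  finally show ?thesis .
qed

text \<open>\<open>D\<close> is the deviation of the control from the feedback law. Integrating
  \<open>riccati_square\<close> over the product space, the exact derivative contributes a constant
  and the term linear in \<open>M\<close> contributes nothing, so the control enters only through
  the square of \<open>D\<close>.\<close>

lemma tracking_cost_eq:
  assumes k: "k > 0" and u: "u \<in> controls T P F" and x: "x = \<xi>0 + z"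
  defines "D \<equiv> \<lambda>t \<omega>. u t \<omega> + riccati T k t * (controlled_state z u t \<omega> - M t \<omega>) / k\<^sup>2"
  shows "integrable (R \<Otimes>\<^sub>M P) (\<lambda>(t, \<omega>). (D t \<omega>)\<^sup>2)"
    and "tracking_cost T P (\<lambda>t \<omega>. \<xi>0 + M t \<omega>) x (k\<^sup>2) u = ennreal
      (riccati T k 0 * z\<^sup>2 / 2 + noise_cost k / 2 + k\<^sup>2 / 2 * integral\<^sup>L (R \<Otimes>\<^sub>M P) (\<lambda>(t, \<omega>). (D t \<omega>)\<^sup>2))"
proof -
  define Z where "Z = controlled_state z u"
  let ?p = "riccati T k" and ?q = "riccati_rate T k"
  have up: "progressively_measurable T F u" and u2: "L2 u" using u by (auto simp: controls_iff)
  have Zp: "progressively_measurable T F Z" and Z2: "L2 Z"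
    unfolding Z_def by (rule progressively_measurable_integral[OF up], rule controlled_state_L2[OF up u2])
  note pc = riccati_continuous(1)[OF k, of T] and qc = riccati_continuous(2)[OF k, of T]
  have pb: "progressively_measurable T F (\<lambda>t \<omega>. ?p t)" "progressively_measurable T F (\<lambda>t \<omega>. ?q t)"
    using borel_measurable_continuous_onI[OF pc] borel_measurable_continuous_onI[OF qc]
    by (auto intro: progressively_measurable_borel)
  define Y where "Y = (\<lambda>t \<omega>. Z t \<omega> - M t \<omega>)"
  have Y2: "L2 Y" unfolding Y_def by (rule L2_diff[OF Z2 M_L2])
  \<comment> \<open>The sign is absorbed into the coefficient so that the sum defining
    \<open>D\<close> is covered by \<open>L2_diff\<close>.\<close>
  have pk: "continuous_on UNIV (\<lambda>t. - (?p t / k\<^sup>2))" using pc k by (intro continuous_intros) auto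
  have D2: "L2 D"
    using L2_diff[OF u2 L2_cmult[OF pk Y2]] by (simp add: D_def Y_def Z_def)
  then show iD: "integrable (R \<Otimes>\<^sub>M P) (\<lambda>(t, \<omega>). (D t \<omega>)\<^sup>2)" by (simp add: L2_def)
  define w where "w = (\<lambda>t \<omega>. ?p t * u t \<omega> - ?q t * Z t \<omega>)"
  have wp: "progressively_measurable T F w" and w2: "L2 w"
    unfolding w_def
    by (intro progressively_measurable_diff progressively_measurable_mult up Zp pb)
       (intro L2_diff L2_cmult pc qc u2 Z2)
  have path: "AE \<omega> in P. (LBINT t:{0..T}. w t \<omega>) = - ?p 0 * z \<and>
      (LBINT t:{0..T}. ?q t * (Z t \<omega>)\<^sup>2 / 2 - ?p t * u t \<omega> * Z t \<omega>) = ?p 0 * z\<^sup>2 / 2"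
    using controlled_state_primitive[OF u2, of z]
  proof eventually_elim
    case (elim \<omega>)
    have "Z 0 \<omega> = z" by (simp add: Z_def controlled_state_def)
    with riccati_path[OF less_imp_le[OF T_pos] k elim[folded Z_def]] show ?case by (simp add: w_def)
  qed
  then have "AE \<omega> in P. (LBINT t:{0..T}. w t \<omega>) = - ?p 0 * z" by eventually_elim simp
  note wM = integral_mult_M_eq_0[OF wp w2 this] and iwM = L2_mult[OF w2 M_L2]
  have iz: "integrable (R \<Otimes>\<^sub>M P) (\<lambda>(t, \<omega>). ?q t * (Z t \<omega>)\<^sup>2 / 2 - ?p t * u t \<omega> * Z t \<omega>)"
    using Bochner_Integration.integrable_diff[OF integrable_divide[OF L2_mult[OF L2_cmult[OF qc Z2] Z2], of 2] L2_mult[OF L2_cmult[OF pc u2] Z2]]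
    by (simp add: split_beta' power2_eq_square mult.assoc)
  have z: "integral\<^sup>L (R \<Otimes>\<^sub>M P) (\<lambda>(t, \<omega>). ?q t * (Z t \<omega>)\<^sup>2 / 2 - ?p t * u t \<omega> * Z t \<omega>) = ?p 0 * z\<^sup>2 / 2"
  proof -
    have "integral\<^sup>L (R \<Otimes>\<^sub>M P) (\<lambda>(t, \<omega>). ?q t * (Z t \<omega>)\<^sup>2 / 2 - ?p t * u t \<omega> * Z t \<omega>)
       = (\<integral>\<omega>. (\<integral>t. ?q t * (Z t \<omega>)\<^sup>2 / 2 - ?p t * u t \<omega> * Z t \<omega> \<partial>R) \<partial>P)"
      by (rule RP.integral_snd[OF iz, symmetric])
    also have "\<dots> = (\<integral>\<omega>. ?p 0 * z\<^sup>2 / 2 \<partial>P)"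
    proof (rule integral_cong_AE)
      show "(\<lambda>\<omega>. \<integral>t. ?q t * (Z t \<omega>)\<^sup>2 / 2 - ?p t * u t \<omega> * Z t \<omega> \<partial>R) \<in> borel_measurable P"
        using RP.integrable_snd[OF iz] by auto
      show "AE \<omega> in P. (\<integral>t. ?q t * (Z t \<omega>)\<^sup>2 / 2 - ?p t * u t \<omega> * Z t \<omega> \<partial>R) = ?p 0 * z\<^sup>2 / 2"
        using path by eventually_elim (simp add: integral_R)
    qed simp
    finally show ?thesis by (simp add: prob_space)
  qed
  note iM = integral_rate_M2[OF k]
  \<comment> \<open>\<open>?G\<close> is the decomposed side of \<open>riccati_square\<close> and
    \<open>?H\<close> the running cost. They agree pointwise, so integrability of the four pieces
    gives that of the cost.\<close>
  let ?G = "\<lambda>x. k\<^sup>2 / 2 * (case x of (t, \<omega>) \<Rightarrow> (D t \<omega>)\<^sup>2) + (case x of (t, \<omega>) \<Rightarrow> ?q t * (M t \<omega>)\<^sup>2) / 2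
      + (case x of (t, \<omega>) \<Rightarrow> ?q t * (Z t \<omega>)\<^sup>2 / 2 - ?p t * u t \<omega> * Z t \<omega>) + (case x of (t, \<omega>) \<Rightarrow> w t \<omega> * M t \<omega>)"
  let ?H = "\<lambda>t \<omega>. (Y t \<omega>)\<^sup>2 / 2 + k\<^sup>2 / 2 * (u t \<omega>)\<^sup>2"
  have GH: "?G = case_prod ?H"
  proof
    fix x :: "real \<times> 'a"
    show "?G x = case_prod ?H x"
      using riccati_square[OF k riccati_rate_eq[OF k], of "Z (fst x) (snd x)" "M (fst x) (snd x)" "u (fst x) (snd x)" T "fst x"]
      by (simp add: split_beta' D_def w_def Y_def Z_def)
  qed
  have iG: "integrable (R \<Otimes>\<^sub>M P) ?G"
    by (intro Bochner_Integration.integrable_add integrable_mult_right integrable_divide iD iM iz iwM)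
  have G: "integral\<^sup>L (R \<Otimes>\<^sub>M P) ?G = riccati T k 0 * z\<^sup>2 / 2 + noise_cost k / 2 + k\<^sup>2 / 2 * integral\<^sup>L (R \<Otimes>\<^sub>M P) (\<lambda>(t, \<omega>). (D t \<omega>)\<^sup>2)"
    by (subst Bochner_Integration.integral_add
        | intro Bochner_Integration.integrable_add integrable_mult_right integrable_divide iD iM iz iwM)+
      (simp add: z wM iM)
  have [measurable]: "(\<lambda>x. Y (fst x) (snd x)) \<in> borel_measurable (R \<Otimes>\<^sub>M P)"
    "(\<lambda>x. u (fst x) (snd x)) \<in> borel_measurable (R \<Otimes>\<^sub>M P)"
    using L2_measurable[OF Y2] L2_measurable[OF u2] by auto
  \<comment> \<open>Shifting the state by \<open>\<xi>0\<close> turns the target into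
    \<open>M\<close> and the initial state into \<open>z\<close>.\<close>
  have Xeq: "controlled_state x u t \<omega> - (\<xi>0 + M t \<omega>) = Y t \<omega>" for t \<omega>
    by (simp add: controlled_state_def Y_def Z_def x)
  have "tracking_cost T P (\<lambda>t \<omega>. \<xi>0 + M t \<omega>) x (k\<^sup>2) u = (\<integral>\<^sup>+\<omega>. (\<integral>\<^sup>+t. ennreal (?H t \<omega>) \<partial>R) \<partial>P)"
    unfolding tracking_cost_def Xeq
  proof (rule nn_integral_cong)
    fix \<omega> assume \<omega>: "\<omega> \<in> space P"
    \<comment> \<open>Sections of jointly measurable functions are measurable at every outcome, so
      the two parts of the cost may be added under the time integral without exceptional
      outcomes.\<close>
    have [measurable]: "(\<lambda>t. Y t \<omega>) \<in> borel_measurable R" "(\<lambda>t. u t \<omega>) \<in> borel_measurable R"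
      using measurable_compose[OF measurable_Pair2'[OF \<omega>] L2_measurable[OF Y2]]
        measurable_compose[OF measurable_Pair2'[OF \<omega>] L2_measurable[OF u2]] by simp_all
    have "ennreal (?H t \<omega>) = ennreal (1/2) * ennreal ((Y t \<omega>)\<^sup>2) + ennreal (k\<^sup>2/2) * ennreal ((u t \<omega>)\<^sup>2)" for t
    proof -
      have "ennreal (?H t \<omega>) = ennreal (1/2 * (Y t \<omega>)\<^sup>2) + ennreal (k\<^sup>2/2 * (u t \<omega>)\<^sup>2)"
        by (subst ennreal_plus[symmetric]) auto
      also have "\<dots> = ennreal (1/2) * ennreal ((Y t \<omega>)\<^sup>2) + ennreal (k\<^sup>2/2) * ennreal ((u t \<omega>)\<^sup>2)"
        by (rule arg_cong2[where f="(+)"]; rule ennreal_mult) auto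
      finally show ?thesis .
    qed
    then have "(\<integral>\<^sup>+t. ennreal (?H t \<omega>) \<partial>R) =
       (\<integral>\<^sup>+t. ennreal (1/2) * ennreal ((Y t \<omega>)\<^sup>2) + ennreal (k\<^sup>2/2) * ennreal ((u t \<omega>)\<^sup>2) \<partial>R)"
      by simp
    also have "\<dots> = ennreal (1/2) * (\<integral>\<^sup>+t. ennreal ((Y t \<omega>)\<^sup>2) \<partial>R) + ennreal (k\<^sup>2/2) * (\<integral>\<^sup>+t. ennreal ((u t \<omega>)\<^sup>2) \<partial>R)"
      by (subst nn_integral_add) (auto simp: nn_integral_cmult)
    finally show "ennreal (1/2) * (\<integral>\<^sup>+t\<in>{0..T}. ennreal ((Y t \<omega>)\<^sup>2) \<partial>lborel)
        + ennreal (k\<^sup>2/2) * (\<integral>\<^sup>+t\<in>{0..T}. ennreal ((u t \<omega>)\<^sup>2) \<partial>lborel) = (\<integral>\<^sup>+t. ennreal (?H t \<omega>) \<partial>R)"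
      by (simp add: nn_integral_R)
  qed
  also have "\<dots> = (\<integral>\<^sup>+x. ennreal (case_prod ?H x) \<partial>(R \<Otimes>\<^sub>M P))"
    by (subst RP.nn_integral_snd[symmetric]) (auto simp: split_beta')
  also have "\<dots> = ennreal (integral\<^sup>L (R \<Otimes>\<^sub>M P) (case_prod ?H))"
    using iG unfolding GH by (intro nn_integral_eq_integral) (auto simp: split_beta')
  finally show "tracking_cost T P (\<lambda>t \<omega>. \<xi>0 + M t \<omega>) x (k\<^sup>2) u = ennreal
      (riccati T k 0 * z\<^sup>2 / 2 + noise_cost k / 2 + k\<^sup>2 / 2 * integral\<^sup>L (R \<Otimes>\<^sub>M P) (\<lambda>(t, \<omega>). (D t \<omega>)\<^sup>2))"
    unfolding G[unfolded GH] .
qed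

end

subsection \<open>The optimal control and the value\<close>

context tracking_problem
begin

text \<open>The feedback law mentions the state it generates. Solving the linear equation explicitly
  expresses the control through \<open>M\<close> alone, so progressive measurability and square
  integrability follow from the closure properties above.\<close>

lemma optimal_control:
  assumes k: "k > 0" and x: "x = \<xi>0 + z"
  obtains u where "u \<in> controls T P F"
    "tracking_cost T P (\<lambda>t \<omega>. \<xi>0 + M t \<omega>) x (k\<^sup>2) u = ennreal (riccati T k 0 * z\<^sup>2 / 2 + noise_cost k / 2)"
proof -
  \<comment> \<open>\<open>h\<close> solves the homogeneous state equation \<open>h' = - (p / k\<^sup>2) h\<close>; variation of constants with
    \<open>r = (1 / h)'\<close> gives the optimal state \<open>h N\<close>.\<close>
  define h where "h = (\<lambda>t. cosh ((T - t) / k))"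
  define h' where "h' = (\<lambda>t. - sinh ((T - t) / k) / k)"
  define r where "r = (\<lambda>t. sinh ((T - t) / k) / (k * (h t)\<^sup>2))"
  \<comment> \<open>The feedback gain, equal to \<open>- p / k\<^sup>2\<close>.\<close>
  define l where "l = (\<lambda>t. - tanh ((T - t) / k) / k)"
  have hpos: "h t > 0" for t by (simp add: h_def)
  have hc: "continuous_on UNIV h" "continuous_on UNIV h'"
    unfolding h_def h'_def using k by (auto intro!: continuous_intros)
  have rc: "continuous_on UNIV r"
    unfolding r_def using k hpos hc(1) by (intro continuous_intros) (auto simp: less_imp_neq[symmetric])
  have lc: "continuous_on UNIV l"
    unfolding l_def using k by (auto intro!: continuous_intros)
  have hp: "primitive_on T h h'"
    using hc(2) k unfolding continuous_on_eq_continuous_at[OF open_UNIV]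
    by (intro primitive_on_FTC) (auto simp: h_def h'_def intro!: derivative_eq_intros)
  have pb: "progressively_measurable T F (\<lambda>t \<omega>. f t)" if "continuous_on UNIV f" for f :: "real \<Rightarrow> real"
    by (intro progressively_measurable_borel borel_measurable_continuous_onI that)
  define w where "w = (\<lambda>t \<omega>. r t * M t \<omega>)"
  \<comment> \<open>The initial value makes \<open>h N\<close> start at \<open>z\<close>.\<close>
  define N where "N = controlled_state (z / h 0) w"
  define u where "u = (\<lambda>t \<omega>. l t * (h t * N t \<omega> - M t \<omega>))"
  have wp: "progressively_measurable T F w" and w2: "L2 w"
    unfolding w_def by (intro progressively_measurable_mult pb rc M_prog) (intro L2_cmult rc M_L2)
  have Np: "progressively_measurable T F N" and N2: "L2 N"
    unfolding N_def by (rule progressively_measurable_integral[OF wp], rule controlled_state_L2[OF wp w2])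
  have up: "progressively_measurable T F u" and u2: "L2 u"
    unfolding u_def
    by (intro progressively_measurable_mult progressively_measurable_diff pb lc hc Np M_prog)
      (intro L2_cmult L2_diff lc hc N2 M_L2)
  have u: "u \<in> controls T P F" using up u2 by (simp add: controls_iff)
  let ?D = "\<lambda>t \<omega>. u t \<omega> + riccati T k t * (controlled_state z u t \<omega> - M t \<omega>) / k\<^sup>2"
  have D: "AE \<omega> in P. \<forall>t\<in>{0..T}. ?D t \<omega> = 0"
    using controlled_state_primitive[OF w2, of "z / h 0"]
  proof eventually_elim
    case (elim \<omega>)
    \<comment> \<open>The product rule gives \<open>h N\<close> the derivative \<open>u\<close>;
      hence \<open>h N\<close> is the state driven by \<open>u\<close>, and \<open>u\<close> indeed
      obeys the feedback law.\<close>
    have eq: "(\<lambda>t. h' t * N t \<omega> + h t * w t \<omega>) = (\<lambda>t. u t \<omega>)"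
    proof
      fix t
      have e: "h t * r t = - l t" "l t * h t = h' t"
        using hpos[of t] k by (auto simp: r_def l_def h_def h'_def tanh_def power2_eq_square)
      have "h' t * N t \<omega> + h t * w t \<omega> = (l t * h t) * N t \<omega> + (h t * r t) * M t \<omega>"
        unfolding e(2) by (simp add: w_def mult.assoc)
      also have "\<dots> = u t \<omega>"
        unfolding e(1) by (simp add: u_def algebra_simps)
      finally show "h' t * N t \<omega> + h t * w t \<omega> = u t \<omega>" .
    qed
    have Z: "primitive_on T (\<lambda>t. h t * N t \<omega>) (\<lambda>t. u t \<omega>)"
      using primitive_on_mult[OF hp elim[folded N_def]] unfolding eq .
    have N0: "N 0 \<omega> = z / h 0" by (simp add: N_def controlled_state_def)
    have "controlled_state z u t \<omega> = h t * N t \<omega>" if "t \<in> {0..T}" for t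
      using primitive_onD(2)[OF Z that] hpos[of 0] by (simp add: controlled_state_def N0)
    then show ?case
      using k by (simp add: u_def l_def riccati_def power2_eq_square)
  qed
  have i: "integrable (R \<Otimes>\<^sub>M P) (case_prod (\<lambda>t \<omega>. (?D t \<omega>)\<^sup>2))"
    by (rule tracking_cost_eq(1)[OF k u x])
  have "integral\<^sup>L (R \<Otimes>\<^sub>M P) (case_prod (\<lambda>t \<omega>. (?D t \<omega>)\<^sup>2)) = (\<integral>\<omega>. (\<integral>t. (?D t \<omega>)\<^sup>2 \<partial>R) \<partial>P)"
    by (rule RP.integral_snd[OF i, symmetric])
  also have "\<dots> = 0"
    by (rule integral_eq_zero_AE, rule eventually_mono[OF D], rule integral_eq_zero_AE)
      (auto intro!: AE_I2 simp: space_R)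
  finally have "integral\<^sup>L (R \<Otimes>\<^sub>M P) (\<lambda>(t, \<omega>). (?D t \<omega>)\<^sup>2) = 0" .
  then show thesis
    using that[OF u] tracking_cost_eq(2)[OF k u x] by simp
qed

lemma tracking_value_eq:
  assumes k: "k > 0"
  shows "tracking_value T P F (\<lambda>t \<omega>. \<xi>0 + M t \<omega>) x (k\<^sup>2) =
    ennreal (riccati T k 0 * (x - \<xi>0)\<^sup>2 / 2 + noise_cost k / 2)"
proof -
  have x: "x = \<xi>0 + (x - \<xi>0)" by simp
  obtain u where u: "u \<in> controls T P F"
    "tracking_cost T P (\<lambda>t \<omega>. \<xi>0 + M t \<omega>) x (k\<^sup>2) u = ennreal (riccati T k 0 * (x - \<xi>0)\<^sup>2 / 2 + noise_cost k / 2)"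
    using optimal_control[OF k x] by blast
  show ?thesis
    unfolding tracking_value_def
  proof (rule antisym)
    show "(INF u\<in>controls T P F. tracking_cost T P (\<lambda>t \<omega>. \<xi>0 + M t \<omega>) x (k\<^sup>2) u)
        \<le> ennreal (riccati T k 0 * (x - \<xi>0)\<^sup>2 / 2 + noise_cost k / 2)"
      by (rule INF_lower2[OF u(1)]) (simp add: u(2))
    show "ennreal (riccati T k 0 * (x - \<xi>0)\<^sup>2 / 2 + noise_cost k / 2)
        \<le> (INF u\<in>controls T P F. tracking_cost T P (\<lambda>t \<omega>. \<xi>0 + M t \<omega>) x (k\<^sup>2) u)"
    proof (rule INF_greatest)
      fix v assume v: "v \<in> controls T P F"
      show "ennreal (riccati T k 0 * (x - \<xi>0)\<^sup>2 / 2 + noise_cost k / 2)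
          \<le> tracking_cost T P (\<lambda>t \<omega>. \<xi>0 + M t \<omega>) x (k\<^sup>2) v"
        unfolding tracking_cost_eq(2)[OF k v x]
        by (intro ennreal_leI le_add_same_cancel1[THEN iffD2] mult_nonneg_nonneg
            Bochner_Integration.integral_nonneg) (auto simp: split_beta')
    qed
  qed
qed

section \<open>The noise cost as a Stieltjes integral against \<open>A\<close>\<close>

lemma integral_riccati_rate:
  assumes k: "k > 0" and t: "t \<in> {0..T}"
  shows "(LBINT s:{t..T}. riccati_rate T k s) = riccati T k t"
    "(\<integral>\<^sup>+s\<in>{t..T}. ennreal (riccati_rate T k s) \<partial>lborel) = ennreal (riccati T k t)"
proof -
  have c: "riccati_rate T k \<in> borel_measurable borel" "isCont (riccati_rate T k) s" for s
    using riccati_continuous(2)[OF k, of T]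
    by (auto intro: borel_measurable_continuous_onI simp: continuous_on_eq_continuous_at)
  have d: "((\<lambda>t. - riccati T k t) has_real_derivative riccati_rate T k s) (at s)" for s
    using DERIV_minus[OF riccati_DERIV[OF k]] by simp
  show "(LBINT s:{t..T}. riccati_rate T k s) = riccati T k t"
    using integral_FTC_Icc_real[OF _ d c(2), of t T] t by (simp add: set_lebesgue_integral_def mult.commute)
  show "(\<integral>\<^sup>+s\<in>{t..T}. ennreal (riccati_rate T k s) \<partial>lborel) = ennreal (riccati T k t)"
    using nn_integral_FTC_Icc[OF c(1) d riccati_rate_bounds(1), of t T] t by simp
qed

abbreviation EA :: "real \<Rightarrow> real" where "EA t \<equiv> \<integral>\<omega>. A t \<omega> \<partial>P"

lemma EA_mono: "s \<in> {0..T} \<Longrightarrow> t \<in> {0..T} \<Longrightarrow> s \<le> t \<Longrightarrow> EA s \<le> EA t"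
  by (intro integral_mono A_integrable mono_onD[OF A_mono])

lemma EA_nonneg: "t \<in> {0..T} \<Longrightarrow> 0 \<le> EA t"
  by (intro Bochner_Integration.integral_nonneg A_nonneg)

lemma integrable_rate_EA:
  assumes "k > 0"
  shows "integrable R (\<lambda>t. riccati_rate T k t * EA t)"
proof -
  have "integrable R (\<lambda>t. \<integral>\<omega>. riccati_rate T k t * (M t \<omega>)\<^sup>2 \<partial>P)"
    by (rule RP.integrable_fst[OF integral_rate_M2(1)[OF assms]])
  then show ?thesis
    by (rule Bochner_Integration.integrable_cong[THEN iffD1, rotated -1])
      (simp_all add: expectation_M2 space_R)
qed

text \<open>Path by path, \<open>riccati\<close> at \<open>t\<close> is the integral of its rate
  over \<open>[t,T]\<close>, so integration by parts moves the Stieltjes integral onto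
  \<open>A\<close> itself. Tonelli then brings the expectation inside the time integral.\<close>

lemma noise_cost_stieltjes:
  assumes k: "k > 0"
  shows "(\<integral>\<^sup>+\<omega>. (\<integral>\<^sup>+t\<in>{0..T}. ennreal (riccati T k t) \<partial>stieltjes_measure T (\<lambda>t. A t \<omega>)) \<partial>P)
    = ennreal (noise_cost k)"
proof -
  let ?q = "riccati_rate T k"
  have [measurable]: "?q \<in> borel_measurable borel"
    by (rule borel_measurable_continuous_onI[OF riccati_continuous(2)[OF k]])
  have [measurable]: "(\<lambda>x. A (fst x) (snd x)) \<in> borel_measurable (R \<Otimes>\<^sub>M P)"
    using prog_measurable_RP[OF A_prog] by (simp add: split_beta')
  have [measurable]: "(\<lambda>x. ?q (fst x)) \<in> borel_measurable (R \<Otimes>\<^sub>M P)"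
    by (intro measurable_compose[OF measurable_fst] measurable_restrict_space1) simp
  have path: "(\<integral>\<^sup>+t\<in>{0..T}. ennreal (riccati T k t) \<partial>stieltjes_measure T (\<lambda>t. A t \<omega>))
      = (\<integral>\<^sup>+t. ennreal (?q t * A t \<omega>) \<partial>R)" if \<omega>: "\<omega> \<in> space P" for \<omega>
  proof -
    have "(\<integral>\<^sup>+t\<in>{0..T}. ennreal (riccati T k t) \<partial>stieltjes_measure T (\<lambda>t. A t \<omega>))
        = (\<integral>\<^sup>+t\<in>{0..T}. (\<integral>\<^sup>+s\<in>{t..T}. ennreal (?q s) \<partial>lborel) \<partial>stieltjes_measure T (\<lambda>t. A t \<omega>))"
      by (intro nn_integral_cong) (simp add: integral_riccati_rate(2)[OF k] split: split_indicator)
    also have "\<dots> = (\<integral>\<^sup>+s\<in>{0..T}. ennreal (?q s) * ennreal (A s \<omega> - A 0 \<omega>) \<partial>lborel)"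
      using T_pos by (intro nn_integral_stieltjes_measure A_continuous A_mono \<omega>) auto
    also have "\<dots> = (\<integral>\<^sup>+t. ennreal (?q t * A t \<omega>) \<partial>R)"
      unfolding nn_integral_R using riccati_rate_bounds(1)[of T k]
      by (intro nn_integral_cong) (auto simp: A_0 ennreal_mult A_nonneg[OF _ \<omega>] split: split_indicator)
    finally show ?thesis .
  qed
  have "(\<integral>\<^sup>+\<omega>. (\<integral>\<^sup>+t\<in>{0..T}. ennreal (riccati T k t) \<partial>stieltjes_measure T (\<lambda>t. A t \<omega>)) \<partial>P)
      = (\<integral>\<^sup>+\<omega>. (\<integral>\<^sup>+t. ennreal (?q t * A t \<omega>) \<partial>R) \<partial>P)"
    by (intro nn_integral_cong path)
  also have "\<dots> = (\<integral>\<^sup>+t. (\<integral>\<^sup>+\<omega>. ennreal (?q t * A t \<omega>) \<partial>P) \<partial>R)"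
    by (rule RP.Fubini') (simp add: split_beta')
  also have "\<dots> = (\<integral>\<^sup>+t. ennreal (?q t * EA t) \<partial>R)"
  proof (rule nn_integral_cong)
    fix t assume "t \<in> space R"
    then have t: "t \<in> {0..T}" by (simp add: space_R)
    then show "(\<integral>\<^sup>+\<omega>. ennreal (?q t * A t \<omega>) \<partial>P) = ennreal (?q t * EA t)"
      using A_integrable[OF t] riccati_rate_bounds(1)[of T k t]
      by (subst nn_integral_eq_integral) (auto intro!: AE_I2 mult_nonneg_nonneg A_nonneg[OF t])
  qed
  also have "\<dots> = ennreal (noise_cost k)"
    unfolding noise_cost_def integral_R[symmetric]
    by (rule nn_integral_eq_integral[OF integrable_rate_EA[OF k]])
      (auto intro!: AE_I2 mult_nonneg_nonneg riccati_rate_bounds EA_nonneg simp: space_R)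
  finally show ?thesis .
qed

section \<open>Asymptotics of the noise cost for small \<open>k\<close>\<close>

lemma riccati_rate_set_integrable: "k > 0 \<Longrightarrow> set_integrable lborel {a..b} (riccati_rate T k)"
  unfolding set_integrable_def
  by (intro borel_integrable_compact) (auto intro: continuous_on_subset[OF riccati_continuous(2)])

text \<open>Replace the mean of \<open>A\<close> by its largest value, at \<open>T\<close>; the rate
  has total mass \<open>k * tanh (T / k)\<close>, which is below \<open>k\<close>.\<close>

lemma noise_cost_upper:
  assumes k: "k > 0"
  shows "noise_cost k \<le> k * EA T"
proof -
  have "noise_cost k \<le> (\<integral>t. riccati_rate T k t * EA T \<partial>R)"
    unfolding noise_cost_def integral_R[symmetric]
    using riccati_rate_set_integrable[OF k, of 0 T]
    by (intro integral_mono integrable_rate_EA k mult_left_mono EA_mono riccati_rate_bounds)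
      (auto simp: space_R integrable_R)
  also have "\<dots> = riccati T k 0 * EA T"
    using integral_riccati_rate(1)[OF k T_mem(2)] by (simp add: integral_R)
  also have "\<dots> \<le> k * EA T"
    using k tanh_real_lt_1[of "T / k"]
    by (intro mult_right_mono EA_nonneg T_mem) (simp add: riccati_def)
  finally show ?thesis .
qed

text \<open>Keep only the final window of length \<open>d\<close>. There the mean of
  \<open>A\<close> is at least its value at \<open>T - d\<close>, and the rate has mass
  \<open>k * tanh (d / k)\<close>.\<close>

lemma noise_cost_lower:
  assumes k: "k > 0" and d: "d \<in> {0..T}"
  shows "k * (tanh (d / k) * EA (T - d)) \<le> noise_cost k"
proof -
  have Td: "T - d \<in> {0..T}" using d by auto
  have i: "integrable R (\<lambda>t. indicator {T - d..T} t * riccati_rate T k t)"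
  proof -
    have "integrable R (riccati_rate T k)"
      using riccati_rate_set_integrable[OF k, of 0 T] by (simp add: integrable_R)
    then have "integrable R (\<lambda>t. indicator ({T - d..T} \<inter> space R) t *\<^sub>R riccati_rate T k t)"
      using sets_restrict_space_iff[of "{0..T}" lborel]
      by (intro integrable_mult_indicator) (auto simp: space_R)
    then show ?thesis
      by (rule Bochner_Integration.integrable_cong[THEN iffD1, rotated -1]) (auto simp: space_R split: split_indicator)
  qed
  have "(LBINT t:{0..T}. indicator {T - d..T} t * riccati_rate T k t) = (LBINT t:{T - d..T}. riccati_rate T k t)"
    unfolding set_lebesgue_integral_def using d
    by (intro Bochner_Integration.integral_cong) (auto split: split_indicator)
  then have "k * (tanh (d / k) * EA (T - d)) = (\<integral>t. indicator {T - d..T} t * riccati_rate T k t * EA (T - d) \<partial>R)"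
    using integral_riccati_rate(1)[OF k Td] by (simp add: integral_R riccati_def)
  also have "\<dots> \<le> noise_cost k"
    unfolding noise_cost_def integral_R[symmetric]
  proof (intro integral_mono integrable_rate_EA k)
    show "integrable R (\<lambda>t. indicator {T - d..T} t * riccati_rate T k t * EA (T - d))"
      using i by simp
    show "indicator {T - d..T} t * riccati_rate T k t * EA (T - d) \<le> riccati_rate T k t * EA t"
      if "t \<in> space R" for t
      using that Td EA_mono[OF Td, of t] EA_nonneg[of t] riccati_rate_bounds(1)[of T k t]
      by (auto simp: space_R mult_left_mono split: split_indicator)
  qed
  finally show ?thesis .
qed

text \<open>Dominated convergence along continuous paths, with the monotone bound \<open>A T\<close>
  as dominating function.\<close>

lemma EA_left_continuous: "((\<lambda>d. EA (T - d)) \<longlongrightarrow> EA T) (at_right 0)"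
proof (rule tendsto_at_right_sequentially[OF T_pos])
  fix S :: "nat \<Rightarrow> real"
  assume S: "\<And>n. 0 < S n" "\<And>n. S n < T" "S \<longlonglongrightarrow> 0"
  have mem: "T - S n \<in> {0..T}" for n using S(1,2)[of n] by auto
  show "(\<lambda>n. EA (T - S n)) \<longlonglongrightarrow> EA T"
  proof (rule integral_dominated_convergence[where w="A T"])
    show "A T \<in> borel_measurable P" "integrable P (A T)" "A (T - S n) \<in> borel_measurable P" for n
      using A_integrable[OF T_mem(1)] A_integrable[OF mem] by auto
    show "AE \<omega> in P. norm (A (T - S n) \<omega>) \<le> A T \<omega>" for n
      using A_nonneg[OF mem] A_le[OF mem] by (intro AE_I2) simp
    show "AE \<omega> in P. (\<lambda>n. A (T - S n) \<omega>) \<longlonglongrightarrow> A T \<omega>"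
    proof (rule AE_I2)
      fix \<omega> assume "\<omega> \<in> space P"
      have "(\<lambda>n. T - S n) \<longlonglongrightarrow> T" using tendsto_diff[OF tendsto_const S(3), of T] by simp
      then show "(\<lambda>n. A (T - S n) \<omega>) \<longlonglongrightarrow> A T \<omega>"
        by (intro continuous_on_tendsto_compose[OF A_continuous[OF \<open>\<omega> \<in> space P\<close>]])
          (use mem T_mem in \<open>auto intro!: always_eventually\<close>)
    qed
  qed
qed

text \<open>Squeeze between the two bounds with window \<open>d = sqrt k\<close>: it shrinks to 0,
  so left-continuity applies, while \<open>d / k\<close> tends to infinity, so the window captures
  asymptotically all the mass of the rate.\<close>

lemma noise_cost_asymptotics: "((\<lambda>k. noise_cost k / k) \<longlongrightarrow> EA T) (at_right 0)"
proof (rule tendsto_sandwich)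
  have s: "filterlim sqrt (at_right 0) (at_right 0)"
    by (intro filterlim_at_withinI tendsto_eq_intros) (auto simp: eventually_at_filter)
  have "filterlim (\<lambda>k. sqrt k / k) at_top (at_right (0::real)) \<longleftrightarrow>
      filterlim (\<lambda>k. inverse (sqrt k)) at_top (at_right (0::real))"
    by (intro filterlim_cong refl, rule eventually_mono[OF eventually_at_right_less])
      (simp add: field_simps)
  then have "filterlim (\<lambda>k. sqrt k / k) at_top (at_right (0::real))"
    using filterlim_compose[OF filterlim_inverse_at_top_right s] by simp
  from tendsto_mult[OF filterlim_compose[OF tanh_real_at_top this] filterlim_compose[OF EA_left_continuous s]]
  show "((\<lambda>k. tanh (sqrt k / k) * EA (T - sqrt k)) \<longlongrightarrow> EA T) (at_right 0)" by simp
  have "eventually (\<lambda>k. k \<in> {0<..<T\<^sup>2}) (at_right 0)"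
    using T_pos by (intro eventually_at_right_real) auto
  then show "\<forall>\<^sub>F k in at_right 0. tanh (sqrt k / k) * EA (T - sqrt k) \<le> noise_cost k / k"
  proof eventually_elim
    case (elim k)
    then have "sqrt k \<in> {0..T}" using T_pos by (auto intro!: real_le_lsqrt)
    with noise_cost_lower[of k "sqrt k"] elim show ?case by (simp add: field_simps)
  qed
  show "\<forall>\<^sub>F k in at_right 0. noise_cost k / k \<le> EA T"
    using eventually_at_right_less[of "0::real"]
    by eventually_elim (use noise_cost_upper in \<open>simp add: field_simps\<close>)
qed simp

text \<open>Vanishing second moments make \<open>M t\<close> zero almost surely at each time. A
  common null set exists for the rational times in \<open>(0,T)\<close>, and path continuity extends
  the equality to all of \<open>[0,T]\<close>.\<close>

lemma M_eq_0_if_EA_eq_0: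
  assumes "EA T = 0" and cont: "\<And>\<omega>. \<omega> \<in> space P \<Longrightarrow> continuous_on {0..T} (\<lambda>t. M t \<omega>)"
  shows "AE \<omega> in P. \<forall>t\<in>{0..T}. M t \<omega> = 0"
proof -
  have M0: "AE \<omega> in P. M t \<omega> = 0" if t: "t \<in> {0..T}" for t
  proof -
    have "(\<integral>\<omega>. (M t \<omega>)\<^sup>2 \<partial>P) = 0"
      using EA_mono[OF t T_mem(1)] EA_nonneg[OF t] t assms(1) by (simp add: expectation_M2[OF t])
    then show ?thesis
      using M2_integrable[OF t] by (simp add: integral_nonneg_eq_0_iff_AE)
  qed
  have "AE \<omega> in P. \<forall>t\<in>{0<..<T} \<inter> \<rat>. M t \<omega> = 0"
    by (subst AE_ball_countable) (auto intro!: M0 countable_rat)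
  with AE_space show ?thesis
  proof eventually_elim
    case (elim \<omega>)
    have "closure ({0<..<T} \<inter> \<rat>) = {0..T}"
      using T_pos by (subst closure_open_Int_superset) (auto simp: Rats_closure_real)
    with continuous_constant_on_closure[of "{0<..<T} \<inter> \<rat>" "\<lambda>t. M t \<omega>" 0] elim cont[of \<omega>]
    show ?case by auto
  qed
qed

end

section \<open>Regular versions and the theorem\<close>

lemma measurable_restrict_null:
  fixes X :: "'a \<Rightarrow> real"
  assumes "X \<in> borel_measurable G" "space G = \<Omega>" "N \<in> sets G"
  shows "(\<lambda>\<omega>. if \<omega> \<in> \<Omega> - N then X \<omega> else 0) \<in> borel_measurable G"
proof (rule measurable_If[OF assms(1)])
  have "{\<omega> \<in> space G. \<omega> \<in> \<Omega> - N} = space G - N" using assms by auto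
  then show "{\<omega> \<in> space G. \<omega> \<in> \<Omega> - N} \<in> sets G" using assms by auto
qed simp

text \<open>The formula lives in \<open>[0,\<infinity>]\<close>; its finiteness makes the passage
  through \<open>enn2real\<close> faithful. Sharpness is read as a two-sided bound of order
  \<open>sqrt \<kappa>\<close>, and the exceptional case as indistinguishability of \<xi> from the
  constant \<open>x\<close>.\<close>

theorem proposition2p6:
  fixes T x \<xi>0 :: real
    and P :: "'a measure"
    and F :: "real \<Rightarrow> 'a measure"
    and M A \<xi> :: "real \<Rightarrow> 'a \<Rightarrow> real"
  assumes "T > 0"
    and "usual_filtered_prob_space T P F"
    and "continuous_square_integrable_martingale T P F M"
    and "AE \<omega> in P. M 0 \<omega> = 0"
    and "quadratic_variation_of T P F M A"
    and "\<And>t \<omega>. t \<in> {0..T} \<Longrightarrow> \<omega> \<in> space P \<Longrightarrow> \<xi> t \<omega> = \<xi>0 + M t \<omega>"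
  shows "(\<forall>\<kappa>>0. tracking_value T P F \<xi> x \<kappa> < \<infinity> \<and>
            tracking_value T P F \<xi> x \<kappa> =
              ennreal (sqrt \<kappa> / 2 * tanh (T / sqrt \<kappa>) * (x - \<xi>0)\<^sup>2) +
              ennreal (1/2) * (\<integral>\<^sup>+\<omega>. (\<integral>\<^sup>+t\<in>{0..T}. ennreal (sqrt \<kappa> * tanh ((T - t) / sqrt \<kappa>))
                                 \<partial>stieltjes_measure T (\<lambda>t. A t \<omega>)) \<partial>P)) \<and>
         (\<lambda>\<kappa>. enn2real (tracking_value T P F \<xi> x \<kappa>)
               - sqrt \<kappa> / 2 * ((x - \<xi>0)\<^sup>2 + (\<integral>\<omega>. A T \<omega> \<partial>P)))
           \<in> o[at_right 0](\<lambda>\<kappa>. sqrt \<kappa>) \<and>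
         (\<not> (AE \<omega> in P. \<forall>t\<in>{0..T}. \<xi> t \<omega> = x) \<longrightarrow>
            (\<lambda>\<kappa>. enn2real (tracking_value T P F \<xi> x \<kappa>)) \<in> \<Theta>[at_right 0](\<lambda>\<kappa>. sqrt \<kappa>))"
proof -
  have usual: "prob_space P" "\<forall>t\<in>{0..T}. subalgebra P (F t)"
    "\<forall>s\<in>{0..T}. \<forall>t\<in>{0..T}. s \<le> t \<longrightarrow> sets (F s) \<subseteq> sets (F t)" "null_sets P \<subseteq> sets (F 0)"
    using assms(2) unfolding usual_filtered_prob_space_def by - (elim conjE, assumption)+
  have mart: "martingale_on T P F M" "\<forall>t\<in>{0..T}. integrable P (\<lambda>\<omega>. (M t \<omega>)\<^sup>2)"
    "AE \<omega> in P. continuous_on {0..T} (\<lambda>t. M t \<omega>)"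
    using assms(3) unfolding continuous_square_integrable_martingale_def by - (elim conjE, assumption)+
  have qv: "\<forall>t\<in>{0..T}. A t \<in> borel_measurable (F t)"
    "AE \<omega> in P. A 0 \<omega> = 0 \<and> continuous_on {0..T} (\<lambda>t. A t \<omega>) \<and> mono_on {0..T} (\<lambda>t. A t \<omega>)"
    "martingale_on T P F (\<lambda>t \<omega>. (M t \<omega>)\<^sup>2 - A t \<omega>)"
    using assms(5) unfolding quadratic_variation_of_def by - (elim conjE, assumption)+
  interpret P: prob_space P by (rule usual(1))
  have T0: "0 \<in> {0..T}" "T \<in> {0..T}" using \<open>T > 0\<close> by auto
  note sub = bspec[OF usual(2)]
  have space: "space (F t) = space P" if "t \<in> {0..T}" for t
    using sub[OF that] by (simp add: subalgebra_def)
  note filt = usual(3)[rule_format]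
  \<comment> \<open>All almost sure regularity is collected in a single null set
    \<open>N\<close>.\<close>
  have "AE \<omega> in P. M 0 \<omega> = 0 \<and> continuous_on {0..T} (\<lambda>t. M t \<omega>) \<and>
      A 0 \<omega> = 0 \<and> continuous_on {0..T} (\<lambda>t. A t \<omega>) \<and> mono_on {0..T} (\<lambda>t. A t \<omega>)" (is "AE \<omega> in P. ?reg \<omega>")
    using assms(4) mart(3) qv(2) by eventually_elim simp
  then obtain N where N: "{\<omega> \<in> space P. \<not> ?reg \<omega>} \<subseteq> N" "emeasure P N = 0" "N \<in> sets P"
    by (rule AE_E)
  then have null: "N \<in> null_sets P" by (intro null_setsI)
  have reg: "?reg \<omega>" if "\<omega> \<in> space P - N" for \<omega> using N(1) that by blast
  have NF: "N \<in> sets (F t)" if "t \<in> {0..T}" for t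
    using filt[OF T0(1) that] that subsetD[OF usual(4) null] by auto
  have nN: "AE \<omega> in P. \<omega> \<in> space P - N"
    using AE_space AE_not_in[OF null] by eventually_elim simp
  have M_ad: "M t \<in> borel_measurable (F t)" and A_ad: "A t \<in> borel_measurable (F t)" if "t \<in> {0..T}" for t
    using mart(1) qv(1) that by (simp_all add: martingale_on_def)
  \<comment> \<open>Completeness of \<open>F 0\<close> allows the exceptional null set to be removed without losing adaptedness.\<close>
  define M' A' where "M' = (\<lambda>t \<omega>. if \<omega> \<in> space P - N then M t \<omega> else 0)"
    and "A' = (\<lambda>t \<omega>. if \<omega> \<in> space P - N then A t \<omega> else 0)"
  have M'_ad: "M' t \<in> borel_measurable (F t)" and A'_ad: "A' t \<in> borel_measurable (F t)"
    if "t \<in> {0..T}" for t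
    unfolding M'_def A'_def
    by (rule measurable_restrict_null[OF M_ad[OF that] space[OF that] NF[OF that]],
      rule measurable_restrict_null[OF A_ad[OF that] space[OF that] NF[OF that]])
  have paths: "(\<lambda>t. M' t \<omega>) = (if \<omega> \<in> space P - N then (\<lambda>t. M t \<omega>) else (\<lambda>_. 0))"
    "(\<lambda>t. A' t \<omega>) = (if \<omega> \<in> space P - N then (\<lambda>t. A t \<omega>) else (\<lambda>_. 0))" for \<omega>
    by (auto simp: M'_def A'_def)
  have zero: "continuous_on {0..T} (\<lambda>_. 0 :: real)" "mono_on {0..T} (\<lambda>_. 0 :: real)"
    by (simp_all add: monotone_on_def)
  have M'_cont: "continuous_on {0..T} (\<lambda>t. M' t \<omega>)" and A'_cont: "continuous_on {0..T} (\<lambda>t. A' t \<omega>)"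
    and A'_mono: "mono_on {0..T} (\<lambda>t. A' t \<omega>)" for \<omega>
    unfolding paths using reg[of \<omega>] zero by (auto simp only: split: if_split)
  have M'M: "AE \<omega> in P. M t \<omega> = M' t \<omega>" and A'A: "AE \<omega> in P. A t \<omega> = A' t \<omega>" for t
    using nN by (eventually_elim, simp add: M'_def A'_def)+
  interpret tracking_problem T P F M' A'
  proof
    show "progressively_measurable T F M'" "progressively_measurable T F A'"
      by (rule progressively_measurable_continuous[OF space filt M'_ad M'_cont]; assumption)
        (rule progressively_measurable_continuous[OF space filt A'_ad A'_cont]; assumption)
    show "martingale_on T P F M'"
      by (rule martingale_on_modification[OF P.prob_space_axioms sub mart(1) M'_ad M'M])
    show "integrable P (\<lambda>\<omega>. (M' t \<omega>)\<^sup>2)" if t: "t \<in> {0..T}" for t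
    proof (rule integrable_cong_AE_imp)
      show "integrable P (\<lambda>\<omega>. (M t \<omega>)\<^sup>2)" using mart(2) t by (rule bspec)
      show "(\<lambda>\<omega>. (M' t \<omega>)\<^sup>2) \<in> borel_measurable P"
        using measurable_from_subalg[OF sub[OF t] M'_ad[OF t]] by measurable
      show "AE \<omega> in P. (M t \<omega>)\<^sup>2 = (M' t \<omega>)\<^sup>2" using M'M[of t] by eventually_elim simp
    qed
    show "martingale_on T P F (\<lambda>t \<omega>. (M' t \<omega>)\<^sup>2 - A' t \<omega>)"
    proof (rule martingale_on_modification[OF P.prob_space_axioms sub])
      show "martingale_on T P F (\<lambda>t \<omega>. (M t \<omega>)\<^sup>2 - A t \<omega>)" by (rule qv(3))
      show "(\<lambda>\<omega>. (M' t \<omega>)\<^sup>2 - A' t \<omega>) \<in> borel_measurable (F t)" if "t \<in> {0..T}" for t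
        using M'_ad[OF that] A'_ad[OF that] by measurable
      show "AE \<omega> in P. (M t \<omega>)\<^sup>2 - A t \<omega> = (M' t \<omega>)\<^sup>2 - A' t \<omega>" for t
        using M'M[of t] A'A[of t] by eventually_elim simp
    qed
    show "M' 0 \<omega> = 0" "A' 0 \<omega> = 0" for \<omega> using reg[of \<omega>] by (auto simp: M'_def A'_def)
  qed (rule \<open>T > 0\<close> P.prob_space_axioms sub A'_cont A'_mono; assumption)+
  have \<xi>: "\<xi> t \<omega> = \<xi>0 + M' t \<omega>" if "t \<in> {0..T}" "\<omega> \<in> space P - N" for t \<omega>
    using assms(6)[OF that(1)] that by (simp add: M'_def)
  \<comment> \<open>The regular version changes the target on a null set only, and the set of
    controls does not mention the target; hence costs and value are unchanged.\<close>
  have "tracking_cost T P \<xi> x \<kappa> u = tracking_cost T P (\<lambda>t \<omega>. \<xi>0 + M' t \<omega>) x \<kappa> u" for \<kappa> u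
    unfolding tracking_cost_def
  proof (rule nn_integral_cong_AE, use nN in eventually_elim)
    case (elim \<omega>)
    have "(\<integral>\<^sup>+t\<in>{0..T}. ennreal ((controlled_state x u t \<omega> - \<xi> t \<omega>)\<^sup>2) \<partial>lborel)
        = (\<integral>\<^sup>+t\<in>{0..T}. ennreal ((controlled_state x u t \<omega> - (\<xi>0 + M' t \<omega>))\<^sup>2) \<partial>lborel)"
      by (rule nn_integral_cong) (simp add: \<xi>[OF _ elim] split: split_indicator)
    then show ?case by simp
  qed
  then have val_eq: "tracking_value T P F \<xi> x \<kappa> =
      ennreal (riccati T (sqrt \<kappa>) 0 * (x - \<xi>0)\<^sup>2 / 2 + noise_cost (sqrt \<kappa>) / 2)" if "\<kappa> > 0" for \<kappa>
    using tracking_value_eq[of "sqrt \<kappa>" \<xi>0 x] that by (simp add: tracking_value_def)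
  have noise: "(\<integral>\<^sup>+\<omega>. (\<integral>\<^sup>+t\<in>{0..T}. ennreal (sqrt \<kappa> * tanh ((T - t) / sqrt \<kappa>))
      \<partial>stieltjes_measure T (\<lambda>t. A t \<omega>)) \<partial>P) = ennreal (noise_cost (sqrt \<kappa>))" if "\<kappa> > 0" for \<kappa>
  proof -
    have "(\<integral>\<^sup>+\<omega>. (\<integral>\<^sup>+t\<in>{0..T}. ennreal (sqrt \<kappa> * tanh ((T - t) / sqrt \<kappa>)) \<partial>stieltjes_measure T (\<lambda>t. A t \<omega>)) \<partial>P)
      = (\<integral>\<^sup>+\<omega>. (\<integral>\<^sup>+t\<in>{0..T}. ennreal (sqrt \<kappa> * tanh ((T - t) / sqrt \<kappa>)) \<partial>stieltjes_measure T (\<lambda>t. A' t \<omega>)) \<partial>P)"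
      by (rule nn_integral_cong_AE, use nN in eventually_elim) (simp add: A'_def)
    also have "\<dots> = ennreal (noise_cost (sqrt \<kappa>))"
      using noise_cost_stieltjes[of "sqrt \<kappa>"] that by (simp add: riccati_def)
    finally show ?thesis .
  qed
  \<comment> \<open>The lower bound with an empty window, \<open>d = 0\<close>.\<close>
  have noise_nonneg: "0 \<le> noise_cost (sqrt \<kappa>)" if "\<kappa> > 0" for \<kappa>
    using noise_cost_lower[of "sqrt \<kappa>" 0] that T0 by simp
  have ric: "riccati T k 0 = k * tanh (T / k)" for k by (simp add: riccati_def)
  define V where "V \<kappa> = enn2real (tracking_value T P F \<xi> x \<kappa>)" for \<kappa>
  define c where "c = (x - \<xi>0)\<^sup>2 + (\<integral>\<omega>. A T \<omega> \<partial>P)"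
  have A_eq: "(\<integral>\<omega>. A T \<omega> \<partial>P) = EA T"
  proof (rule integral_cong_AE)
    show "A T \<in> borel_measurable P" "A' T \<in> borel_measurable P"
      by (rule measurable_from_subalg[OF sub[OF T0(2)] A_ad[OF T0(2)]],
          rule measurable_from_subalg[OF sub[OF T0(2)] A'_ad[OF T0(2)]])
  qed (rule A'A)
  \<comment> \<open>All asymptotic claims come from this one limit, that of the value divided by
    \<open>sqrt \<kappa>\<close>; it equals \<open>c / 2\<close>.\<close>
  have "((\<lambda>\<kappa>. tanh (T / sqrt \<kappa>) * (x - \<xi>0)\<^sup>2 / 2 + noise_cost (sqrt \<kappa>) / sqrt \<kappa> / 2)
      \<longlongrightarrow> 1 * (x - \<xi>0)\<^sup>2 / 2 + EA T / 2) (at_right 0)"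
  proof (intro tendsto_intros)
    have s: "filterlim sqrt (at_right 0) (at_right 0)"
      by (intro filterlim_at_withinI tendsto_eq_intros) (auto simp: eventually_at_filter)
    show "((\<lambda>\<kappa>. noise_cost (sqrt \<kappa>) / sqrt \<kappa>) \<longlongrightarrow> EA T) (at_right 0)"
      by (rule filterlim_compose[OF noise_cost_asymptotics s])
    have "filterlim (\<lambda>\<kappa>. T * inverse (sqrt \<kappa>)) at_top (at_right 0)"
      by (rule filterlim_tendsto_pos_mult_at_top[OF tendsto_const \<open>T > 0\<close>])
        (rule filterlim_compose[OF filterlim_inverse_at_top_right s])
    then show "((\<lambda>\<kappa>. tanh (T / sqrt \<kappa>)) \<longlongrightarrow> 1) (at_right 0)"
      unfolding divide_inverse by (rule filterlim_compose[OF tanh_real_at_top])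
  qed simp_all
  moreover have "V \<kappa> / sqrt \<kappa> = tanh (T / sqrt \<kappa>) * (x - \<xi>0)\<^sup>2 / 2 + noise_cost (sqrt \<kappa>) / sqrt \<kappa> / 2"
    if "\<kappa> > 0" for \<kappa>
    using that noise_nonneg[OF that] \<open>T > 0\<close>
    by (simp add: V_def val_eq ric enn2real_ennreal field_simps)
  then have "\<forall>\<^sub>F \<kappa> in at_right 0. tanh (T / sqrt \<kappa>) * (x - \<xi>0)\<^sup>2 / 2 + noise_cost (sqrt \<kappa>) / sqrt \<kappa> / 2 = V \<kappa> / sqrt \<kappa>"
    by (intro eventually_mono[OF eventually_at_right_less]) simp
  ultimately have "((\<lambda>\<kappa>. V \<kappa> / sqrt \<kappa>) \<longlongrightarrow> 1 * (x - \<xi>0)\<^sup>2 / 2 + EA T / 2) (at_right 0)"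
    by (rule Lim_transform_eventually)
  moreover have "1 * (x - \<xi>0)\<^sup>2 / 2 + EA T / 2 = c / 2"
    by (simp add: c_def A_eq)
  ultimately have lim: "((\<lambda>\<kappa>. V \<kappa> / sqrt \<kappa>) \<longlongrightarrow> c / 2) (at_right 0)" by (simp only:)
  have nz: "\<forall>\<^sub>F \<kappa> in at_right 0. sqrt \<kappa> \<noteq> 0"
    by (rule eventually_mono[OF eventually_at_right_less[of 0]]) simp
  show ?thesis
  proof (intro conjI allI impI)
    fix \<kappa> :: real assume \<kappa>: "\<kappa> > 0"
    show "tracking_value T P F \<xi> x \<kappa> < \<infinity>" by (simp add: val_eq[OF \<kappa>])
    have "ennreal (riccati T (sqrt \<kappa>) 0 * (x - \<xi>0)\<^sup>2 / 2 + noise_cost (sqrt \<kappa>) / 2)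
        = ennreal (riccati T (sqrt \<kappa>) 0 * (x - \<xi>0)\<^sup>2 / 2) + ennreal (1/2 * noise_cost (sqrt \<kappa>))"
      using \<kappa> noise_nonneg[OF \<kappa>] \<open>T > 0\<close> by (subst ennreal_plus[symmetric]) (auto simp: ric)
    also have "ennreal (1/2 * noise_cost (sqrt \<kappa>)) = ennreal (1/2) * ennreal (noise_cost (sqrt \<kappa>))"
      using noise_nonneg[OF \<kappa>] by (intro ennreal_mult) auto
    finally show "tracking_value T P F \<xi> x \<kappa> =
        ennreal (sqrt \<kappa> / 2 * tanh (T / sqrt \<kappa>) * (x - \<xi>0)\<^sup>2) +
        ennreal (1/2) * (\<integral>\<^sup>+\<omega>. (\<integral>\<^sup>+t\<in>{0..T}. ennreal (sqrt \<kappa> * tanh ((T - t) / sqrt \<kappa>))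
                           \<partial>stieltjes_measure T (\<lambda>t. A t \<omega>)) \<partial>P)"
      unfolding val_eq[OF \<kappa>] noise[OF \<kappa>] ric by simp
  next
    have "((\<lambda>\<kappa>. V \<kappa> / sqrt \<kappa> - c / 2) \<longlongrightarrow> 0) (at_right 0)"
      using lim by (simp add: LIM_zero)
    moreover have "\<forall>\<^sub>F \<kappa> in at_right 0. V \<kappa> / sqrt \<kappa> - c / 2 = (V \<kappa> - sqrt \<kappa> / 2 * c) / sqrt \<kappa>"
      using nz by eventually_elim (simp add: field_simps)
    ultimately show "(\<lambda>\<kappa>. enn2real (tracking_value T P F \<xi> x \<kappa>)
        - sqrt \<kappa> / 2 * ((x - \<xi>0)\<^sup>2 + (\<integral>\<omega>. A T \<omega> \<partial>P))) \<in> o[at_right 0](\<lambda>\<kappa>. sqrt \<kappa>)"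
      unfolding V_def[symmetric] c_def[symmetric]
      by (intro smalloI_tendsto nz) (rule Lim_transform_eventually)
  next
    assume nt: "\<not> (AE \<omega> in P. \<forall>t\<in>{0..T}. \<xi> t \<omega> = x)"
    \<comment> \<open>As a sum of two nonnegative terms, \<open>c\<close> vanishes only if
      \<open>x = \<xi>0\<close> and the mean of \<open>A T\<close> is zero. Then \<open>M\<close> is
      almost surely zero and \<xi> stays at \<open>x\<close>. Otherwise the ratio has a nonzero
      finite limit, which gives the two-sided bound.\<close>
    have "c \<noteq> 0"
    proof
      assume "c = 0"
      then have "(x - \<xi>0)\<^sup>2 = 0" "EA T = 0"
        using EA_nonneg[OF T0(2)] by (auto simp: c_def A_eq add_nonneg_eq_0_iff)
      then have "x = \<xi>0" "EA T = 0" by auto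
      with M_eq_0_if_EA_eq_0[OF _ M'_cont] have "AE \<omega> in P. \<forall>t\<in>{0..T}. M' t \<omega> = 0" by blast
      with nN have "AE \<omega> in P. \<forall>t\<in>{0..T}. \<xi> t \<omega> = x"
        by eventually_elim (simp add: \<xi> \<open>x = \<xi>0\<close>)
      with nt show False by contradiction
    qed
    then show "(\<lambda>\<kappa>. enn2real (tracking_value T P F \<xi> x \<kappa>)) \<in> \<Theta>[at_right 0](\<lambda>\<kappa>. sqrt \<kappa>)"
      unfolding V_def[symmetric] by (intro bigthetaI_tendsto[OF _ lim]) auto
  qed
qed

end
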